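(* A tree $T$ is a unit rectangle visibility graph if and only if $T$ is the union of two subdivided caterpillar forests, each with maximum degree at most $3$.
   Context: A finite simple graph $G$ is a unit rectangle visibility graph (URVG) if its vertices $v$ can be represented by closed unit squares $S_v$ in the plane with sides parallel to the coordinate axes and with pairwise disjoint interiors (squares may touch along their boundaries), in such a way that two distinct vertices $v,w$ are adjacent if and only if there is an unobstructed non-degenerate (positive width) horizontal or vertical band of visibility joining $S_v$ and $S_w$. Here a horizontal band of visibility joining $S_v$ and $S_w$ is given by an open interval $I$ of positive length such that for every $y_0\in I$ the line $y=y_0$ meets the interiors of both $S_v$ and $S_w$, and the part of this line between $S_v$ and $S_w$ (possibly a single point if the squares touch) meets the interior of no other square of the representation; vertical bands are defined analogously with the roles of $x$ and $y$ exchanged. A caterpillar is a tree in which all vertices of degree greater than $1$ lie on a single path. A subdivided caterpillar is a tree obtained from a caterpillar by replacing each edge by a path of arbitrary length (at least $1$). A subdivided caterpillar forest is a forest each of whose connected components is a subdivided caterpillar (isolated vertices are allowed). "$T$ is the union of two forests" means that $T$ has two such subgraphs whose edge sets together cover all edges of $T$. *)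

theory Defs
  imports
    "HOL-Analysis.Analysis"
    "Graph_Theory.Graph_Theory"
begin

text \<open>
  Finite simple graphs are the symmetric loop-free finite pair digraphs \<^locale>\<open>pair_graph\<close>:
  an edge is a pair of opposite arcs, so the degree of a vertex is its \<^const>\<open>out_degree\<close>.

  The constants \<^const>\<open>forest\<close> and \<^const>\<open>tree\<close> of the library forbid every directed cycle,
  including the closed walk u, v, u along one edge of a symmetric digraph, and hence do not
  describe undirected forests and trees. In a \<^locale>\<open>pair_graph\<close> the undirected cycles are exactly
  the directed cycles of length at least 3.
\<close>

definition undirected_forest :: "'a pair_pre_digraph \<Rightarrow> bool" where
  "undirected_forest G \<longleftrightarrow>
     pair_graph G \<and> \<not> (\<exists>p. pre_digraph.cycle (with_proj G) p \<and> length p \<ge> 3)"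

definition undirected_tree :: "'a pair_pre_digraph \<Rightarrow> bool" where
  "undirected_tree G \<longleftrightarrow> undirected_forest G \<and> Digraph_Component.connected (with_proj G)"

definition caterpillar :: "'a pair_pre_digraph \<Rightarrow> bool" where
  "caterpillar G \<longleftrightarrow> undirected_tree G \<and>
     (\<exists>p. vpath p (with_proj G) \<and>
        {v \<in> pverts G. out_degree (with_proj G) v > 1} \<subseteq> set p)"

text \<open>
  \<^term>\<open>subdivision_pair G H\<close> says that \<^term>\<open>H\<close> arises from \<^term>\<open>G\<close> by finitely many (possibly no)
  steps, each inserting one new vertex into an edge, that is, by replacing each edge of
  \<^term>\<open>G\<close> by a path of length at least 1.
\<close>

definition subdivided_caterpillar :: "'a pair_pre_digraph \<Rightarrow> bool" where
  "subdivided_caterpillar H \<longleftrightarrow>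
     undirected_tree H \<and> (\<exists>G. caterpillar G \<and> subdivision_pair G H)"

text \<open>
  In a symmetric digraph the strongly connected components are the connected components.
\<close>

definition subdivided_caterpillar_forest :: "'a pair_pre_digraph \<Rightarrow> bool" where
  "subdivided_caterpillar_forest F \<longleftrightarrow> undirected_forest F \<and>
     (\<forall>C. with_proj C \<in> pre_digraph.sccs (with_proj F) \<longrightarrow> subdivided_caterpillar C)"

definition max_degree_at_most :: "nat \<Rightarrow> 'a pair_pre_digraph \<Rightarrow> bool" where
  "max_degree_at_most k G \<longleftrightarrow> (\<forall>v \<in> pverts G. out_degree (with_proj G) v \<le> k)"

definition unit_square :: "(real \<times> real) set \<Rightarrow> bool" where
  "unit_square Q \<longleftrightarrow> (\<exists>a b. Q = cbox (a, b) (a + 1, b + 1))"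

text \<open>
  Horizontal and vertical visibility are treated at once. The sight lines are the lines on
  which the coordinate \<^term>\<open>t\<close> is constant, and \<^term>\<open>s\<close> is the coordinate along them:
  \<^term>\<open>s = fst\<close>, \<^term>\<open>t = snd\<close> gives horizontal lines, and \<^term>\<open>s = snd\<close>, \<^term>\<open>t = fst\<close> vertical ones.

  If the line \<^term>\<open>t = c\<close> meets both \<^term>\<open>A\<close> and \<^term>\<open>B\<close>, then \<open>line_part_after s t A B c\<close> is the part
  of the line weakly after \<^term>\<open>A\<close> and weakly before \<^term>\<open>B\<close>. When \<^term>\<open>A\<close> and \<^term>\<open>B\<close> are squares with
  disjoint interiors, and the line meets both interiors, one of \<open>line_part_after s t A B c\<close> and
  \<open>line_part_after s t B A c\<close> is empty and the other is the closed segment (a single point if the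
  squares touch) joining \<^term>\<open>A\<close> and \<^term>\<open>B\<close>.
\<close>

definition line_part_after ::
  "(real \<times> real \<Rightarrow> real) \<Rightarrow> (real \<times> real \<Rightarrow> real) \<Rightarrow>
   (real \<times> real) set \<Rightarrow> (real \<times> real) set \<Rightarrow> real \<Rightarrow> (real \<times> real) set" where
  "line_part_after s t A B c =
     {p. t p = c \<and> (\<forall>a \<in> A. t a = c \<longrightarrow> s a \<le> s p) \<and> (\<forall>b \<in> B. t b = c \<longrightarrow> s p \<le> s b)}"

definition line_part_between ::
  "(real \<times> real \<Rightarrow> real) \<Rightarrow> (real \<times> real \<Rightarrow> real) \<Rightarrow>
   (real \<times> real) set \<Rightarrow> (real \<times> real) set \<Rightarrow> real \<Rightarrow> (real \<times> real) set" where
  "line_part_between s t A B c = line_part_after s t A B c \<union> line_part_after s t B A c"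

definition visibility_band ::
  "(real \<times> real \<Rightarrow> real) \<Rightarrow> (real \<times> real \<Rightarrow> real) \<Rightarrow>
   'a set \<Rightarrow> ('a \<Rightarrow> (real \<times> real) set) \<Rightarrow> 'a \<Rightarrow> 'a \<Rightarrow> bool" where
  "visibility_band s t V S v w \<longleftrightarrow>
     (\<exists>l r. l < r \<and>
        (\<forall>c \<in> {l<..<r}.
           {p. t p = c} \<inter> interior (S v) \<noteq> {} \<and>
           {p. t p = c} \<inter> interior (S w) \<noteq> {} \<and>
           (\<forall>u \<in> V - {v, w}. line_part_between s t (S v) (S w) c \<inter> interior (S u) = {})))"

abbreviation horizontal_band ::
  "'a set \<Rightarrow> ('a \<Rightarrow> (real \<times> real) set) \<Rightarrow> 'a \<Rightarrow> 'a \<Rightarrow> bool" where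
  "horizontal_band \<equiv> visibility_band fst snd"

abbreviation vertical_band ::
  "'a set \<Rightarrow> ('a \<Rightarrow> (real \<times> real) set) \<Rightarrow> 'a \<Rightarrow> 'a \<Rightarrow> bool" where
  "vertical_band \<equiv> visibility_band snd fst"

definition URVG :: "'a pair_pre_digraph \<Rightarrow> bool" where
  "URVG G \<longleftrightarrow> pair_graph G \<and>
     (\<exists>S. (\<forall>v \<in> pverts G. unit_square (S v)) \<and>
          pairwise (\<lambda>v w. interior (S v) \<inter> interior (S w) = {}) (pverts G) \<and>
          (\<forall>v \<in> pverts G. \<forall>w \<in> pverts G. v \<noteq> w \<longrightarrow>
             ((v, w) \<in> parcs G \<longleftrightarrow>
                horizontal_band (pverts G) S v w \<or> vertical_band (pverts G) S v w)))"

end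

theory Submission
  imports Defs
begin

text \<open>
  In a representation of a tree, the horizontal visibilities form a forest. Two squares met by a
  common horizontal line are joined by a chain of visibilities along this line, so two neighbours
  of a square \<open>v\<close> met by a line that misses \<open>v\<close>, or lying on the same side of \<open>v\<close> and met by
  a common line, would close a cycle. Hence \<open>v\<close> has at most three neighbours, and if it has three, two of
  them lie on one side and the third is aligned with \<open>v\<close>, as are all further squares of its
  branch: this branch is a pendant path. Without these pendant paths all degrees are at most 2, so
  the vertices of degree 3 of a component lie on a path.

  Conversely, the vertices of degree 3 of a component lie on a path that cannot be prolonged. The
  \<open>i\<close>-th vertex of the path is put at height \<open>i / 2\<close>, and its pendant path at the same height, to the
  left for even \<open>i\<close> and to the right for odd \<open>i\<close>. Visibility only
  depends on the heights and on the order of adjacent vertices from left to right. Since the tree has no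
  cycles, the components of one forest can be moved along their axis as a whole so that the order
  required by the other forest is obtained.
\<close>

text \<open>Both directions meet in one property: a tree is a subdivided caterpillar exactly if its
  vertices of degree at least 3 lie on a path. Subdivision only adds vertices of degree 2, and
  conversely vertices of degree 2 off the path can be suppressed until a caterpillar remains.
  Heights are multiples of 1/2 because unit squares at levels \<open>i\<close> and
  \<open>i + 1\<close> must overlap in height, whereas those at levels \<open>i\<close> and
  \<open>i + 2\<close> must not. Pendant paths at consecutive levels therefore share sight lines,
  which is why they leave to opposite sides. The coordinate that spreads the levels of one forest is
  the one along which the other forest looks, so the two layouts are coupled. They are compatible
  because prescribed differences on the edges of a forest always come from a potential, and because
  distinct vertices never share a component in both forests, which keeps their squares
  disjoint.\<close>

section \<open>Forests as edge relations\<close>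

text \<open>Every edge is a bridge. This form of acyclicity speaks of reachability only, passes to
  symmetric subrelations and suits induction by deletion of an edge.\<close>

definition forest_rel :: "'a rel \<Rightarrow> bool" where
  "forest_rel E \<longleftrightarrow> sym E \<and> (\<forall>u v. (u, v) \<in> E \<longrightarrow> (u, v) \<notin> (E - {(u, v), (v, u)})\<^sup>*)"

lemma forest_relD:
  assumes "forest_rel E"
  shows "sym E" and "(u, v) \<in> E \<Longrightarrow> (u, v) \<notin> (E - {(u, v), (v, u)})\<^sup>*"
  using assms by (auto simp: forest_rel_def)

lemma forest_rel_irrefl:
  assumes "forest_rel E" "(u, v) \<in> E"
  shows "u \<noteq> v"
  using assms by (auto simp: forest_rel_def)

lemma forest_rel_subset:
  assumes "forest_rel E" "E' \<subseteq> E" "sym E'"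
  shows "forest_rel E'"
  unfolding forest_rel_def
proof (intro conjI allI impI notI)
  fix u v assume "(u, v) \<in> E'" "(u, v) \<in> (E' - {(u, v), (v, u)})\<^sup>*"
  moreover have "(E' - {(u, v), (v, u)})\<^sup>* \<subseteq> (E - {(u, v), (v, u)})\<^sup>*"
    using assms(2) by (intro rtrancl_mono) auto
  ultimately show False
    using assms by (auto simp: forest_rel_def)
qed fact

text \<open>The walk from \<open>a\<close> to \<open>b\<close> misses \<open>v\<close>; continued by
  the edge from \<open>b\<close> to \<open>v\<close>, it bypasses the edge between \<open>v\<close>
  and \<open>a\<close>.\<close>

lemma forest_rel_no_cycle:
  assumes E: "forest_rel E" and va: "(v, a) \<in> E" and vb: "(v, b) \<in> E" and "a \<noteq> b"
    and ab: "(a, b) \<in> (E \<inter> (- {v}) \<times> (- {v}))\<^sup>*"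
  shows False
proof -
  have bv: "(b, v) \<in> E - {(v, a), (a, v)}"
    using vb \<open>a \<noteq> b\<close> forest_relD(1)[OF E] forest_rel_irrefl[OF E vb] by (auto dest: symD)
  have "(E \<inter> (- {v}) \<times> (- {v}))\<^sup>* \<subseteq> (E - {(v, a), (a, v)})\<^sup>*"
    by (intro rtrancl_mono) auto
  with ab have "(a, b) \<in> (E - {(v, a), (a, v)})\<^sup>*" by blast
  from this bv have "(a, v) \<in> (E - {(v, a), (a, v)})\<^sup>*" by (rule rtrancl_into_rtrancl)
  then have "(a, v) \<in> (E - {(a, v), (v, a)})\<^sup>*" by (simp add: insert_commute)
  moreover have "(a, v) \<in> E"
    using va forest_relD(1)[OF E] by (auto dest: symD)
  ultimately show False
    using forest_relD(2)[OF E] by blast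
qed

text \<open>A walk is cut before its first and after its last use of the edge. If these two uses
  have opposite directions, the remaining pieces share an endpoint and join.\<close>

lemma rtrancl_delete_edge_cases:
  assumes "(u, w) \<in> E\<^sup>*"
  obtains "(u, w) \<in> (E - {(a, b), (b, a)})\<^sup>*"
  | "(u, a) \<in> (E - {(a, b), (b, a)})\<^sup>*" "(b, w) \<in> (E - {(a, b), (b, a)})\<^sup>*"
  | "(u, b) \<in> (E - {(a, b), (b, a)})\<^sup>*" "(a, w) \<in> (E - {(a, b), (b, a)})\<^sup>*"
proof -
  let ?D = "(E - {(a, b), (b, a)})\<^sup>*"
  from assms have "(u, w) \<in> ?D \<or> (u, a) \<in> ?D \<and> (b, w) \<in> ?D \<or> (u, b) \<in> ?D \<and> (a, w) \<in> ?D"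
  proof (induction rule: rtrancl_induct)
    case (step y z)
    show ?case
    proof (cases "(y, z) \<in> {(a, b), (b, a)}")
      case True
      then show ?thesis using step.IH by auto
    next
      case False
      with step.hyps have "(y, z) \<in> E - {(a, b), (b, a)}" by blast
      then show ?thesis using step.IH by (meson rtrancl.rtrancl_into_rtrancl)
    qed
  qed auto
  then show thesis using that by blast
qed

lemma sym_delete_edge: "sym E \<Longrightarrow> sym (E - {(a, b), (b, a)})"
  by (auto simp: sym_def)

lemma sym_rtrancl_swap: "sym E \<Longrightarrow> (u, v) \<in> E\<^sup>* \<Longrightarrow> (v, u) \<in> E\<^sup>*"
  by (meson symD sym_rtrancl)

text \<open>If deleting an edge \<open>(a, b)\<close> of \<open>E1\<close> breaks the walk from
  \<open>u\<close> to \<open>w\<close>, then the walk in \<open>E2\<close> and the two remaining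
  pieces join \<open>a\<close> to \<open>b\<close> around this edge, although it is a bridge of the
  union. Later this keeps squares disjoint.\<close>

lemma forest_rel_disjoint_union:
  assumes "finite E1" "forest_rel (E1 \<union> E2)" "sym E1" "sym E2" "E1 \<inter> E2 = {}"
    and "(u, w) \<in> E1\<^sup>*" "(u, w) \<in> E2\<^sup>*"
  shows "u = w"
  using assms
proof (induction E1 arbitrary: u w rule: finite_psubset_induct)
  case (psubset E1)
  show ?case
  proof (cases "E1 = {}")
    case True
    then show ?thesis using psubset.prems by simp
  next
    case False
    then obtain a b where ab: "(a, b) \<in> E1" by auto
    let ?D = "E1 - {(a, b), (b, a)}"
    have symD1: "sym ?D" using psubset.prems by (intro sym_delete_edge)
    have sym2: "sym (E1 \<union> E2 - {(a, b), (b, a)})"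
      using psubset.prems by (intro sym_delete_edge) (auto simp: sym_Un)
    have sub1: "?D\<^sup>* \<subseteq> (E1 \<union> E2 - {(a, b), (b, a)})\<^sup>*"
      by (intro rtrancl_mono) auto
    have "(b, a) \<in> E1" using ab psubset.prems by (auto dest: symD)
    then have sub2: "E2\<^sup>* \<subseteq> (E1 \<union> E2 - {(a, b), (b, a)})\<^sup>*"
      using ab psubset.prems by (intro rtrancl_mono) blast
    have uw2: "(u, w) \<in> (E1 \<union> E2 - {(a, b), (b, a)})\<^sup>*"
      using psubset.prems sub2 by blast
    have bridge: "(a, b) \<notin> (E1 \<union> E2 - {(a, b), (b, a)})\<^sup>*"
      using psubset.prems ab by (auto simp: forest_rel_def)
    from \<open>(u, w) \<in> E1\<^sup>*\<close> show ?thesis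
    proof (cases rule: rtrancl_delete_edge_cases[of _ _ _ a b])
      case 1
      have F: "forest_rel (?D \<union> E2)"
        using psubset.prems symD1 by (intro forest_rel_subset[OF psubset.prems(1)]) (auto simp: sym_Un)
      have D: "?D \<subset> E1" "?D \<inter> E2 = {}"
        using ab psubset.prems(4) by auto
      show ?thesis
        by (rule psubset.IH[OF D(1) F symD1 psubset.prems(3) D(2) 1 psubset.prems(6)])
    next
      case 2
      then have "(a, u) \<in> (E1 \<union> E2 - {(a, b), (b, a)})\<^sup>*" "(w, b) \<in> (E1 \<union> E2 - {(a, b), (b, a)})\<^sup>*"
        using sub1 by (blast intro: sym_rtrancl_swap[OF sym2])+
      from rtrancl_trans[OF rtrancl_trans[OF this(1) uw2] this(2)] show ?thesis
        using bridge by contradiction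
    next
      case 3
      then have "(u, b) \<in> (E1 \<union> E2 - {(a, b), (b, a)})\<^sup>*" "(a, w) \<in> (E1 \<union> E2 - {(a, b), (b, a)})\<^sup>*"
        using sub1 by auto
      from rtrancl_trans[OF this(2) rtrancl_trans[OF sym_rtrancl_swap[OF sym2 uw2] this(1)]]
      show ?thesis using bridge by contradiction
    qed
  qed
qed

lemma forest_rel_potential:
  fixes \<delta> :: "'a \<Rightarrow> 'a \<Rightarrow> int"
  assumes "finite E" "forest_rel E" "\<And>u v. (u, v) \<in> E \<Longrightarrow> \<delta> v u = - \<delta> u v"
  shows "\<exists>g. \<forall>u v. (u, v) \<in> E \<longrightarrow> g v - g u = \<delta> u v"
  using assms
proof (induction E rule: finite_psubset_induct)
  case (psubset E)
  show ?case
  proof (cases "E = {}")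
    case False
    then obtain a b where ab: "(a, b) \<in> E" by auto
    let ?D = "E - {(a, b), (b, a)}"
    have symE: "sym E" using psubset.prems by (auto simp: forest_rel_def)
    then have sym_del: "sym ?D" by (rule sym_delete_edge)
    have F: "forest_rel ?D"
      using sym_del by (intro forest_rel_subset[OF psubset.prems(1)]) auto
    have "?D \<subset> E" using ab by blast
    from psubset.IH[OF this F] obtain g where g: "\<And>u v. (u, v) \<in> ?D \<Longrightarrow> g v - g u = \<delta> u v"
      using psubset.prems(2) by (metis DiffD1)
    \<comment> \<open>The side of \<open>b\<close> is shifted as a whole by the error that
      \<open>g\<close> makes on the deleted edge, so all other differences stay as they are.\<close>
    define h where "h v = (if (b, v) \<in> ?D\<^sup>* then g v + (\<delta> a b - (g b - g a)) else g v)" for v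
    have nab: "(a, b) \<notin> ?D\<^sup>*"
      using psubset.prems ab by (auto simp: forest_rel_def)
    then have nba: "(b, a) \<notin> ?D\<^sup>*"
      using sym_rtrancl_swap[OF sym_del] by blast
    have "h v - h u = \<delta> u v" if uv: "(u, v) \<in> E" for u v
    proof (cases "(u, v) \<in> ?D")
      case True
      then have "(v, u) \<in> ?D" using sym_del by (auto dest: symD)
      with True have "(b, u) \<in> ?D\<^sup>* \<longleftrightarrow> (b, v) \<in> ?D\<^sup>*"
        using rtrancl_into_rtrancl[of b u ?D v] rtrancl_into_rtrancl[of b v ?D u] by blast
      then show ?thesis using g[OF True] by (auto simp: h_def)
    next
      case False
      with uv consider "u = a" "v = b" | "u = b" "v = a" by blast
      then show ?thesis
      proof cases
        case 1
        then show ?thesis using nba by (simp add: h_def)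
      next
        case 2
        then show ?thesis using nba psubset.prems(2)[OF ab] by (simp add: h_def)
      qed
    qed
    then show ?thesis by blast
  qed auto
qed

section \<open>Comparison with the cycles of the library\<close>

lemma pcas_rtrancl: "pcas u p v \<Longrightarrow> set p \<subseteq> R \<Longrightarrow> (u, v) \<in> R\<^sup>*"
  by (induction u p v rule: pcas.induct) (auto intro: converse_rtrancl_into_rtrancl)

lemma pcas_arc_in_verts:
  "pcas u p v \<Longrightarrow> e \<in> set p \<Longrightarrow> fst e \<in> set (pawalk_verts u p) \<and> snd e \<in> set (pawalk_verts u p)"
proof (induction u p v rule: pcas.induct)
  case (2 u e' es v)
  have "snd e' \<in> set (pawalk_verts (snd e') es)" by (cases es) (use 2 in auto)
  then show ?case using 2 by auto
qed auto

lemma pcas_last_in_verts: "pcas u p v \<Longrightarrow> v \<in> set (pawalk_verts u p)"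
  by (induction u p v rule: pcas.induct) auto

text \<open>A path around a deleted edge is closed by this edge to a cycle of length at least 3;
  conversely the rest of such a cycle leads around its first arc.\<close>

lemma undirected_forest_iff:
  "undirected_forest G \<longleftrightarrow> pair_graph G \<and> forest_rel (parcs G)"
proof (cases "pair_graph G")
  case True
  then interpret pair_graph G .
  let ?E = "parcs G"
  have symE: "sym ?E" using pair_sym_arcs by (simp add: symmetric_def)
  have "\<exists>p. cycle p \<and> length p \<ge> 3" if uv: "(u, v) \<in> ?E" "(u, v) \<in> (?E - {(u, v), (v, u)})\<^sup>*" for u v
  proof -
    define G' where "G' = G\<lparr>parcs := ?E - {(u, v), (v, u)}\<rparr>"
    interpret G': pair_wf_digraph G'
      by unfold_locales (auto simp: G'_def dest: wellformed')
    have "u \<in> pverts G'" using uv by (auto simp: G'_def dest: wellformed')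
    moreover have "(u, v) \<in> (parcs G')\<^sup>*" using uv by (simp add: G'_def)
    ultimately have "u \<rightarrow>\<^sup>*\<^bsub>with_proj G'\<^esub> v"
      by (simp add: G'.reachable_conv')
    then obtain p where p: "G'.apath u p v"
      using G'.reachable_apath by blast
    then have p': "set p \<subseteq> ?E - {(u, v), (v, u)}" "pcas u p v" "distinct (pawalk_verts u p)"
      unfolding G'.apath_def G'.awalk_def by (auto simp: G'_def)
    have "u \<noteq> v" using no_loops[OF uv(1)] by simp
    have len: "length p \<ge> 2"
    proof (rule ccontr)
      assume "\<not> length p \<ge> 2"
      then consider "p = []" | e where "p = [e]" by (cases p) (auto simp: not_le less_Suc_eq)
      then show False
      proof cases
        case 1
        then show False using p' \<open>u \<noteq> v\<close> by simp
      next
        case 2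
        then have "e = (u, v)" using p' by (cases e) simp
        then show False using p' 2 by simp
      qed
    qed
    have "awalk v ((v, u) # p) v"
      using uv p' symE by (auto simp: awalk_def dest: wellformed' symD)
    then have "cycle ((v, u) # p)"
      using p' unfolding cycle_def by (intro exI[of _ v]) auto
    then show ?thesis using len by (intro exI[of _ "(v, u) # p"]) auto
  qed
  moreover have False if cyc: "cycle p" "length p \<ge> 3" and F: "forest_rel ?E" for p
  proof -
    from cyc obtain x where x: "awalk x p x" "distinct (tl (pawalk_verts x p))" by (auto simp: cycle_def)
    obtain e1 e2 q where p: "p = e1 # e2 # q" and "q \<noteq> []"
      using cyc(2) by (cases p; cases "tl p"; cases "tl (tl p)") auto
    obtain y z where "e1 = (x, y)" "e2 = (y, z)"
      using x(1) unfolding p awalk_def by (cases e1; cases e2) auto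
    note p = p[unfolded this]
    from x p have q: "pcas z q x" "set q \<subseteq> ?E" "distinct (y # pawalk_verts z q)" "(x, y) \<in> ?E" "(y, z) \<in> ?E"
      by (auto simp: awalk_def)
    obtain e q' where eq: "q = e # q'" using \<open>q \<noteq> []\<close> by (cases q) auto
    have "pcas (snd e) q' x" using q eq by auto
    then have "x \<in> set (pawalk_verts (snd e) q')" by (rule pcas_last_in_verts)
    \<comment> \<open>The length of at least 3 enters here: \<open>q\<close> is nonempty, so
      \<open>z\<close> and the final vertex \<open>x\<close> are different entries of a distinct
      list, and \<open>(y, z)\<close> is not the reversed first arc.\<close>
    then have "z \<noteq> x" using q eq by auto
    have "y \<noteq> x" using pcas_last_in_verts[OF q(1)] q by auto
    have "set q \<subseteq> ?E - {(y, x), (x, y)}"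
      using pcas_arc_in_verts[OF q(1)] q by fastforce
    then have "(z, x) \<in> (?E - {(y, x), (x, y)})\<^sup>*" by (rule pcas_rtrancl[OF q(1)])
    moreover have "(y, z) \<in> ?E - {(y, x), (x, y)}" using q \<open>z \<noteq> x\<close> \<open>y \<noteq> x\<close> by auto
    ultimately have "(y, x) \<in> (?E - {(y, x), (x, y)})\<^sup>*"
 
      by (rule converse_rtrancl_into_rtrancl[rotated])
    moreover have "(y, x) \<in> ?E" using q symE by (auto dest: symD)
    ultimately show False using F by (auto simp: forest_rel_def)
  qed
  ultimately show ?thesis
    using True symE unfolding undirected_forest_def forest_rel_def by blast
qed (auto simp: undirected_forest_def)

section \<open>Layout of a single forest\<close>

text \<open>
  \<^term>\<open>lev v\<close> is the position on the spine of the vertex whose pendant path contains \<^term>\<open>v\<close>, and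
  \<^term>\<open>d v\<close> is the distance of \<^term>\<open>v\<close> to the spine. In this form, with injectivity required only
  within components, the property is inherited by subforests.
\<close>

definition coords :: "'a rel \<Rightarrow> ('a \<Rightarrow> nat) \<Rightarrow> ('a \<Rightarrow> nat) \<Rightarrow> bool" where
  "coords E lev d \<longleftrightarrow>
     (\<forall>u v. (u, v) \<in> E \<longrightarrow>
        lev u = lev v \<and> (d u = Suc (d v) \<or> d v = Suc (d u)) \<or>
        (lev u = Suc (lev v) \<or> lev v = Suc (lev u)) \<and> d u = 0 \<and> d v = 0) \<and>
     (\<forall>u w. (u, w) \<in> E\<^sup>* \<longrightarrow> lev u = lev w \<longrightarrow> d u = d w \<longrightarrow> u = w)"

text \<open>
  The order along the sight lines. Pendant paths point in opposite directions at consecutive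
  vertices of the spine, so that the ranks at consecutive levels do not overlap.
\<close>

definition coord_rank :: "('a \<Rightarrow> nat) \<Rightarrow> ('a \<Rightarrow> nat) \<Rightarrow> 'a \<Rightarrow> int" where
  "coord_rank lev d v = (if even (lev v) then - int (d v) else 1 + int (d v))"

lemma coords_edge:
  assumes "coords E lev d" "(u, v) \<in> E"
  obtains "lev u = lev v" "d u = Suc (d v) \<or> d v = Suc (d u)"
  | "lev u = Suc (lev v) \<or> lev v = Suc (lev u)" "d u = 0" "d v = 0"
proof -
  from assms have "lev u = lev v \<and> (d u = Suc (d v) \<or> d v = Suc (d u)) \<or>
    (lev u = Suc (lev v) \<or> lev v = Suc (lev u)) \<and> d u = 0 \<and> d v = 0"
    unfolding coords_def by simp
  then show thesis using that by auto
qed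

lemma coords_inj:
  assumes "coords E lev d" "(u, w) \<in> E\<^sup>*" "lev u = lev w" "d u = d w"
  shows "u = w"
  using assms by (simp add: coords_def)

lemma coords_subset:
  assumes "coords E lev d" "E' \<subseteq> E"
  shows "coords E' lev d"
  using assms rtrancl_mono[OF assms(2)] unfolding coords_def by blast

text \<open>Spine vertices have rank 0 or 1 according to the parity of their level, so edges along
  the spine change the rank by one as well.\<close>

lemma rank_edge:
  assumes "coords E lev d" "(u, v) \<in> E"
  shows "coord_rank lev d v = coord_rank lev d u + 1 \<or> coord_rank lev d u = coord_rank lev d v + 1"
  by (rule coords_edge[OF assms]) (auto simp: coord_rank_def)

definition level_edges :: "'a rel \<Rightarrow> ('a \<Rightarrow> nat) \<Rightarrow> 'a rel" where
  "level_edges E lev = {(a, b) \<in> E. lev a = lev b}"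

definition up_edges :: "'a rel \<Rightarrow> ('a \<Rightarrow> nat) \<Rightarrow> ('a \<Rightarrow> nat) \<Rightarrow> 'a rel" where
  "up_edges E lev d = {(a, b) \<in> E. lev a = lev b \<and> coord_rank lev d b = coord_rank lev d a + 1}"

lemma level_edges_rtranclD:
  assumes "(u, a) \<in> (level_edges E lev)\<^sup>*"
  shows "lev a = lev u" "(u, a) \<in> E\<^sup>*"
  using assms by (induction rule: rtrancl_induct) (auto simp: level_edges_def)

lemma up_edges_rtranclD:
  assumes "(u, a) \<in> (up_edges E lev d)\<^sup>*"
  shows "lev a = lev u \<and> coord_rank lev d u \<le> coord_rank lev d a \<and> (coord_rank lev d u = coord_rank lev d a \<longrightarrow> u = a)"
  using assms by (induction rule: rtrancl_induct) (auto simp: up_edges_def)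

text \<open>Within a component, a level can be left or entered only at its single vertex with
  \<open>d\<close> equal to 0. A walk returning to the level of \<open>u\<close> therefore re-enters
  where it left, and the excursion can be cut out.\<close>

lemma level_crossing:
  assumes E: "sym E" "coords E lev d" and ua: "(u, a) \<in> E\<^sup>*"
  shows "(lev a = lev u \<longrightarrow> (u, a) \<in> (level_edges E lev)\<^sup>*) \<and>
    (lev a > lev u \<longrightarrow> (\<exists>p q. (u, p) \<in> (level_edges E lev)\<^sup>* \<and> (p, q) \<in> E \<and> lev q = Suc (lev u))) \<and>
    (lev a < lev u \<longrightarrow> (\<exists>p q. (u, p) \<in> (level_edges E lev)\<^sup>* \<and> (p, q) \<in> E \<and> lev u = Suc (lev q)))"
  using ua
proof (induction rule: rtrancl_induct)
  case (step a b)
  have returns: "p = b" if "lev b = lev u" "lev a \<noteq> lev u"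
    "(u, p) \<in> (level_edges E lev)\<^sup>*" "(p, q) \<in> E" "lev q \<noteq> lev u" for p q
  proof -
    have "lev p = lev u" "(u, p) \<in> E\<^sup>*"
      using level_edges_rtranclD[OF that(3)] by auto
    moreover have "d p = 0"
      by (rule coords_edge[OF E(2) that(4)]) (use that \<open>lev p = lev u\<close> in auto)
    moreover have "d b = 0"
      by (rule coords_edge[OF E(2) step.hyps(2)]) (use that in auto)
    moreover have "(p, b) \<in> E\<^sup>*"
      using sym_rtrancl_swap[OF E(1) \<open>(u, p) \<in> E\<^sup>*\<close>] step.hyps by (meson rtrancl.rtrancl_into_rtrancl rtrancl_trans)
    ultimately show ?thesis
      using coords_inj[OF E(2)] that by auto
  qed
  have ab: "lev b = lev a \<or> lev b = Suc (lev a) \<or> lev a = Suc (lev b)"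
    by (rule coords_edge[OF E(2) step.hyps(2)]) auto
  consider "lev a = lev u" | "lev a < lev u" | "lev a > lev u" by linarith
  then show ?case
  proof cases
    case 1
    then have ua: "(u, a) \<in> (level_edges E lev)\<^sup>*" using step.IH by simp
    moreover have "(u, b) \<in> (level_edges E lev)\<^sup>*" if "lev b = lev u"
      using ua by (rule rtrancl_into_rtrancl) (use step.hyps 1 that in \<open>simp add: level_edges_def\<close>)
    ultimately show ?thesis using step.hyps 1 ab by force
  next
    case 2
    then obtain p q where "(u, p) \<in> (level_edges E lev)\<^sup>*" "(p, q) \<in> E" "lev u = Suc (lev q)"
      using step.IH by auto
    then show ?thesis using returns[of p q] 2 ab by auto
  next
    case 3
    then obtain p q where "(u, p) \<in> (level_edges E lev)\<^sup>*" "(p, q) \<in> E" "lev q = Suc (lev u)"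
      using step.IH by auto
    then show ?thesis using returns[of p q] 3 ab by auto
  qed
qed auto

text \<open>The rank is injective on each level of a component, so a walk within a level can only
  turn by retracing its last edge.\<close>

lemma level_edges_monotone:
  assumes E: "sym E" "coords E lev d" and ua: "(u, a) \<in> (level_edges E lev)\<^sup>*"
  shows "(u, a) \<in> (up_edges E lev d)\<^sup>* \<or> (a, u) \<in> (up_edges E lev d)\<^sup>*"
  using ua
proof (induction rule: rtrancl_induct)
  case (step a b)
  let ?r = "coord_rank lev d" and ?U = "up_edges E lev d"
  have ab: "(a, b) \<in> E" "lev a = lev b" using step.hyps by (auto simp: level_edges_def)
  have ba: "(b, a) \<in> E" using ab E(1) by (auto dest: symD)
  have inj: "x = y" if "(x, y) \<in> E\<^sup>*" "lev x = lev y" "?r x = ?r y" for x y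
    using coords_inj[OF E(2) that(1,2)] that by (auto simp: coord_rank_def split: if_splits)
  from rank_edge[OF E(2) ab(1)] consider "(a, b) \<in> ?U" | "(b, a) \<in> ?U"
    using ab ba by (auto simp: up_edges_def)
  then show ?case
  proof cases
    case 1
    show ?thesis
    proof (cases "(u, a) \<in> ?U\<^sup>*")
      case True
      then show ?thesis using 1 by (meson rtrancl.rtrancl_into_rtrancl)
    next
      case False
      then have "(a, u) \<in> ?U\<^sup>*" "a \<noteq> u" using step.IH by auto
      then obtain z where z: "(a, z) \<in> ?U" "(z, u) \<in> ?U\<^sup>*" by (blast elim: converse_rtranclE)
      have "(b, z) \<in> E\<^sup>*" using ba z(1) by (auto simp: up_edges_def)
      then have "b = z" using 1 z(1) by (intro inj) (auto simp: up_edges_def)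
      then show ?thesis using z by simp
    qed
  next
    case 2
    show ?thesis
    proof (cases "(a, u) \<in> ?U\<^sup>*")
      case True
      then show ?thesis using 2 by (meson converse_rtrancl_into_rtrancl)
    next
      case False
      then have "(u, a) \<in> ?U\<^sup>*" "a \<noteq> u" using step.IH by auto
      then obtain z where z: "(u, z) \<in> ?U\<^sup>*" "(z, a) \<in> ?U" by (blast elim: rtranclE)
      have "(z, b) \<in> E\<^sup>*" using ab z(2) by (auto simp: up_edges_def)
      then have "z = b" using 2 z(2) by (intro inj) (auto simp: up_edges_def)
      then show ?thesis using z by simp
    qed
  qed
qed auto

text \<open>The levels allowed by \<open>near\<close> are those whose squares can meet a common
  line. On one level the walk is monotone. On consecutive levels the ranks are at most 0 on the even
  one and at least 1 on the odd one, so the chain runs to the spine at rank 0, crosses to rank 1 and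
  goes outwards.\<close>

lemma rank_chain:
  assumes E: "sym E" "coords E lev d" and uw: "(u, w) \<in> E\<^sup>*"
    and near: "lev u = lev w \<or> lev u = Suc (lev w) \<or> lev w = Suc (lev u)"
    and less: "coord_rank lev d u < coord_rank lev d w"
  shows "(u, w) \<in> {(a, b) \<in> E. lev a \<in> {lev u, lev w} \<and> lev b \<in> {lev u, lev w} \<and>
    coord_rank lev d b = coord_rank lev d a + 1}\<^sup>+" (is "_ \<in> ?C\<^sup>+")
proof -
  let ?r = "coord_rank lev d" and ?U = "up_edges E lev d"
  have into_C: "(a, b) \<in> ?C\<^sup>*" if "(a, b) \<in> ?U\<^sup>*" "lev a \<in> {lev u, lev w}" for a b
    using that
  proof (induction rule: rtrancl_induct)
    case (step b c)
    then have "(b, c) \<in> ?C" using up_edges_rtranclD[OF step.hyps(1)] by (auto simp: up_edges_def)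
    from rtrancl_into_rtrancl[OF step.IH[OF step.prems] this] show ?case .
  qed auto
  show ?thesis
  proof (cases "lev u = lev w")
    case True
    then have "(u, w) \<in> (level_edges E lev)\<^sup>*" using level_crossing[OF E uw] by simp
    then have "(u, w) \<in> ?U\<^sup>*"
      using level_edges_monotone[OF E, of u w] up_edges_rtranclD[of w u E lev d] less by auto
    then have "(u, w) \<in> ?C\<^sup>*" by (rule into_C) simp
    then show ?thesis using less by (auto dest: rtranclD)
  next
    case False
    obtain p q where p: "(u, p) \<in> (level_edges E lev)\<^sup>*" and pq: "(p, q) \<in> E" and q: "lev q = lev w"
    proof (cases "lev w < lev u")
      case True
      then obtain p q where "(u, p) \<in> (level_edges E lev)\<^sup>*" "(p, q) \<in> E" "lev u = Suc (lev q)"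
        using level_crossing[OF E uw] by blast
      then show ?thesis using that[of p q] near True by auto
    next
      case no: False
      then obtain p q where "(u, p) \<in> (level_edges E lev)\<^sup>*" "(p, q) \<in> E" "lev q = Suc (lev u)"
        using level_crossing[OF E uw] False by (auto simp: not_less le_less)
      then show ?thesis using that[of p q] near False no by auto
    qed
    have levp: "lev p = lev u" and up: "(u, p) \<in> E\<^sup>*" using level_edges_rtranclD[OF p] by auto
    have d0: "d p = 0" "d q = 0"
      by (rule coords_edge[OF E(2) pq]; use False levp q in simp)+
    have parity: "even (lev u) \<longleftrightarrow> odd (lev w)" using near False by auto
    have ev: "even (lev u)" using less parity by (auto simp: coord_rank_def split: if_splits)
    have rp: "?r p = 0" "?r q = 1" "?r u \<le> 0" "?r w \<ge> 1"
      using ev parity levp q d0 by (auto simp: coord_rank_def)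
    have "(q, w) \<in> E\<^sup>*"
      using rtrancl_trans[OF sym_rtrancl_swap[OF E(1) rtrancl_into_rtrancl[OF up pq]] uw] .
    then have "(q, w) \<in> (level_edges E lev)\<^sup>*" using level_crossing[OF E] q by simp
    then have "(q, w) \<in> ?U\<^sup>*"
      using level_edges_monotone[OF E, of q w] up_edges_rtranclD[of w q E lev d] rp by auto
    moreover have "(u, p) \<in> ?U\<^sup>*"
      using level_edges_monotone[OF E p] up_edges_rtranclD[of p u E lev d] rp by auto
    ultimately have "(u, p) \<in> ?C\<^sup>*" "(q, w) \<in> ?C\<^sup>*" using q by (intro into_C; simp)+
    moreover have "(p, q) \<in> ?C" using pq rp levp q by simp
    ultimately show ?thesis by (intro trancl_rtrancl_trancl[OF rtrancl_into_trancl1])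
  qed
qed

lemma rank_neq:
  assumes E: "coords E lev d" and uw: "(u, w) \<in> E\<^sup>*" "u \<noteq> w"
    and near: "lev u = lev w \<or> lev u = Suc (lev w) \<or> lev w = Suc (lev u)"
  shows "coord_rank lev d u \<noteq> coord_rank lev d w"
  using near coords_inj[OF E uw(1)] uw(2) by (auto simp: coord_rank_def)

text \<open>
  Visibility of unit squares in coordinates: the square of \<^term>\<open>v\<close> starts at \<^term>\<open>s v\<close> along the
  sight lines and at \<^term>\<open>t v\<close> across them.
\<close>

definition sees :: "'a set \<Rightarrow> ('a \<Rightarrow> real) \<Rightarrow> ('a \<Rightarrow> real) \<Rightarrow> 'a \<Rightarrow> 'a \<Rightarrow> bool" where
  "sees V t s v w \<longleftrightarrow>
     (\<exists>l r. l < r \<and> (\<forall>c \<in> {l<..<r}. c \<in> {t v<..<t v + 1} \<and> c \<in> {t w<..<t w + 1} \<and>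
        (\<forall>u \<in> V - {v, w}. c \<in> {t u<..<t u + 1} \<longrightarrow>
           \<not> (s v < s u \<and> s u < s w) \<and> \<not> (s w < s u \<and> s u < s v))))"

lemma sees_sym: "sees V t s v w \<longleftrightarrow> sees V t s w v"
proof -
  have "sees V t s w v" if "sees V t s v w" for v w
  proof -
    from that obtain l r where lr: "l < r" "\<forall>c \<in> {l<..<r}. c \<in> {t v<..<t v + 1} \<and> c \<in> {t w<..<t w + 1} \<and>
        (\<forall>u \<in> V - {v, w}. c \<in> {t u<..<t u + 1} \<longrightarrow>
           \<not> (s v < s u \<and> s u < s w) \<and> \<not> (s w < s u \<and> s u < s v))"
      unfolding sees_def by blast
    show ?thesis
      unfolding sees_def
    proof (rule exI[of _ l], rule exI[of _ r], intro conjI ballI lr(1))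
      fix c assume "c \<in> {l<..<r}"
      note * = lr(2)[rule_format, OF this]
      show "c \<in> {t w<..<t w + 1}" "c \<in> {t v<..<t v + 1}" using * by simp_all
      fix u assume "u \<in> V - {w, v}"
      then show "c \<in> {t u<..<t u + 1} \<longrightarrow> \<not> (s w < s u \<and> s u < s v) \<and> \<not> (s v < s u \<and> s u < s w)"
        using * by simp
    qed
  qed
  then show ?thesis by blast
qed

text \<open>The coordinate \<open>s\<close> is constrained on edges only: it increases along chains
  of ranks and thus orders all squares on a common line as the rank does. This leaves room for
  \<open>s\<close> to be the level coordinate of the other forest.\<close>

lemma sees_coords:
  assumes E: "sym E" "coords E lev d" and V: "\<And>u v. (u, v) \<in> E \<Longrightarrow> v \<in> V"
    and t: "\<And>v. t v = real (lev v) / 2 + off v"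
    and off_eq: "\<And>u v. (u, v) \<in> E\<^sup>* \<Longrightarrow> off u = off v"
    and far: "\<And>u v. u \<in> V \<Longrightarrow> v \<in> V \<Longrightarrow> (u, v) \<notin> E\<^sup>* \<Longrightarrow> \<bar>t u - t v\<bar> \<ge> 1"
    and s: "\<And>u v. (u, v) \<in> E \<Longrightarrow> coord_rank lev d v = coord_rank lev d u + 1 \<Longrightarrow> s u < s v"
    and uw: "u \<in> V" "w \<in> V" "u \<noteq> w"
  shows "sees V t s u w \<longleftrightarrow> (u, w) \<in> E"
proof -
  let ?r = "coord_rank lev d"
  define near where "near u w \<longleftrightarrow> lev u = lev w \<or> lev u = Suc (lev w) \<or> lev w = Suc (lev u)" for u w
  \<comment> \<open>Within a component the offsets agree, so heights differing by less than 1 belong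
    to levels differing by at most one.\<close>
  have overlap: "(a, b) \<in> E\<^sup>*" "near a b"
    if "a \<in> V" "b \<in> V" "c \<in> {t a<..<t a + 1}" "c \<in> {t b<..<t b + 1}" for a b c
  proof -
    have lt: "\<bar>t a - t b\<bar> < 1" using that by auto
    then show ab: "(a, b) \<in> E\<^sup>*" using far that by force
    show "near a b" using lt off_eq[OF ab] unfolding t near_def by linarith
  qed
  have mono: "s a < s b" if "(a, b) \<in> {(a, b) \<in> E. P a \<and> P b \<and> ?r b = ?r a + 1}\<^sup>+" for a b P
    using that by (induction rule: trancl_induct) (use s in \<open>force+\<close>)
  have chain: "(a, b) \<in> {(x, y) \<in> E. lev x \<in> {lev a, lev b} \<and> lev y \<in> {lev a, lev b} \<and> ?r y = ?r x + 1}\<^sup>+"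
    if "(a, b) \<in> E\<^sup>*" "near a b" "?r a < ?r b" for a b
    using rank_chain[OF E that(1) _ that(3)] that(2) by (simp add: near_def)
  have r_less: "?r a < ?r b" if "(a, b) \<in> E\<^sup>*" "near a b" "s a < s b" for a b
  proof (rule ccontr)
    assume "\<not> ?r a < ?r b"
    moreover have "a \<noteq> b" using that by auto
    ultimately have "?r b < ?r a" using rank_neq[OF E(2) that(1)] that(2) unfolding near_def by fastforce
    moreover have "(b, a) \<in> E\<^sup>*" "near b a"
      using that E(1) by (auto simp: near_def intro: sym_rtrancl_swap)
    ultimately have "s b < s a" using mono[OF chain[of b a]] by blast
    then show False using that by simp
  qed
  have sees_up: "(a, b) \<in> E" if ab: "a \<in> V" "b \<in> V" "s a < s b" and sees: "sees V t s a b" for a b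
  proof -
    from sees obtain l r where lr: "l < r" and clear: "\<And>c. c \<in> {l<..<r} \<Longrightarrow> c \<in> {t a<..<t a + 1} \<and>
      c \<in> {t b<..<t b + 1} \<and> (\<forall>u \<in> V - {a, b}. c \<in> {t u<..<t u + 1} \<longrightarrow> \<not> (s a < s u \<and> s u < s b))"
      unfolding sees_def by blast
    obtain c where c: "c \<in> {l<..<r}" using dense[OF lr] by auto
    have conn: "(a, b) \<in> E\<^sup>*" "near a b" using overlap[of a b c] ab clear[OF c] by auto
    have "?r a < ?r b" using r_less[OF conn] ab by simp
    from chain[OF conn this] obtain z where
      z: "(a, z) \<in> {(x, y) \<in> E. lev x \<in> {lev a, lev b} \<and> lev y \<in> {lev a, lev b} \<and> ?r y = ?r x + 1}" and
      zb: "z = b \<or> (z, b) \<in> {(x, y) \<in> E. lev x \<in> {lev a, lev b} \<and> lev y \<in> {lev a, lev b} \<and> ?r y = ?r x + 1}\<^sup>+"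
      by (rule converse_tranclE) blast+
    show ?thesis
    proof (rule ccontr)
      assume no: "(a, b) \<notin> E"
      then have "z \<noteq> b" using z by auto
      then have "s z < s b" using zb mono[of z b "\<lambda>x. lev x \<in> {lev a, lev b}"] by blast
      moreover have "s a < s z" using z s by auto
      \<comment> \<open>Since the chain stays on the two levels, every line that meets both squares
        also meets \<open>z\<close>, which blocks the band.\<close>
      moreover have "t z = t a \<or> t z = t b"
      proof -
        have "off z = off a" using z off_eq[OF r_into_rtrancl, of a z] by simp
        moreover have "off a = off b" using conn(1) by (rule off_eq)
        ultimately show ?thesis using z by (auto simp: t)
      qed
      moreover have "z \<in> V" using z V by auto
      moreover have "z \<noteq> a" using \<open>s a < s z\<close> by auto
      ultimately show False using clear[OF c] \<open>z \<noteq> b\<close> by auto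
    qed
  qed
  have up_sees: "sees V t s a b" if ab: "(a, b) \<in> E" "?r b = ?r a + 1" "a \<in> V" "b \<in> V" for a b
  proof -
    have nab: "near a b" by (rule coords_edge[OF E(2) ab(1)]) (auto simp: near_def)
    have off: "off a = off b" using off_eq ab by blast
    define l where "l = max (t a) (t b)"
    define r where "r = min (t a) (t b) + 1"
    have "l < r" using nab off by (auto simp: l_def r_def t near_def)
    moreover have "c \<in> {t a<..<t a + 1} \<and> c \<in> {t b<..<t b + 1} \<and>
        (\<forall>u \<in> V - {a, b}. c \<in> {t u<..<t u + 1} \<longrightarrow>
           \<not> (s a < s u \<and> s u < s b) \<and> \<not> (s b < s u \<and> s u < s a))" if c: "c \<in> {l<..<r}" for c
    proof (intro conjI ballI impI notI)
      show ca: "c \<in> {t a<..<t a + 1}" and cb: "c \<in> {t b<..<t b + 1}" using c by (auto simp: l_def r_def)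
      fix q assume q: "q \<in> V - {a, b}" "c \<in> {t q<..<t q + 1}"
      \<comment> \<open>A blocking \<open>q\<close> would have a rank strictly between consecutive
        integers.\<close>
      show False if "s a < s q \<and> s q < s b"
      proof -
        have "?r a < ?r q" using overlap[of a q c] ab q ca that by (intro r_less) auto
        moreover have "?r q < ?r b" using overlap[of q b c] ab q cb that by (intro r_less) auto
        ultimately show False using ab by simp
      qed
      show False if "s b < s q \<and> s q < s a"
        using that s[OF ab(1,2)] by auto
    qed
    ultimately show ?thesis unfolding sees_def by blast
  qed
  show ?thesis
  proof
    assume sees: "sees V t s u w"
    then obtain c where "c \<in> {t u<..<t u + 1}" "c \<in> {t w<..<t w + 1}"
      unfolding sees_def by (meson dense greaterThanLessThan_iff)
    then have conn: "(u, w) \<in> E\<^sup>*" "near u w" using overlap uw by auto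
    then have "?r u \<noteq> ?r w" using rank_neq[OF E(2)] uw by (auto simp: near_def)
    then consider "?r u < ?r w" | "?r w < ?r u" by linarith
    then show "(u, w) \<in> E"
    proof cases
      case 1
      then have "s u < s w" using mono[OF chain[OF conn]] by simp
      then show ?thesis using sees_up[OF uw(1,2) _ sees] by simp
    next
      case 2
      have "(w, u) \<in> E\<^sup>*" "near w u" using conn E(1) by (auto simp: near_def intro: sym_rtrancl_swap)
      then have "s w < s u" using mono[OF chain[of w u]] 2 by simp
      then have "(w, u) \<in> E" using sees_up[OF uw(2,1) _ iffD1[OF sees_sym sees]] by simp
      then show ?thesis using E(1) by (auto dest: symD)
    qed
  next
    assume uw_E: "(u, w) \<in> E"
    then have wu_E: "(w, u) \<in> E" using E(1) by (auto dest: symD)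
    from rank_edge[OF E(2) uw_E] show "sees V t s u w"
    proof
      assume "?r w = ?r u + 1"
      then show ?thesis by (rule up_sees[OF uw_E _ uw(1,2)])
    next
      assume "?r u = ?r w + 1"
      then have "sees V t s w u" by (rule up_sees[OF wu_E _ uw(2,1)])
      then show ?thesis by (rule iffD1[OF sees_sym])
    qed
  qed
qed

section \<open>Paths through the vertices of degree 3\<close>

definition rel_path :: "'a rel \<Rightarrow> 'a list \<Rightarrow> bool" where
  "rel_path E p \<longleftrightarrow> p \<noteq> [] \<and> distinct p \<and> successively (\<lambda>a b. (a, b) \<in> E) p"

lemma rel_path_inner:
  assumes E: "sym E" and p: "rel_path E p" and a: "a \<in> set p" "a \<noteq> hd p" "a \<noteq> last p"
  obtains x y where "x \<in> set p" "y \<in> set p" "x \<noteq> y" "(a, x) \<in> E" "(a, y) \<in> E"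
proof -
  obtain ys zs where split: "p = ys @ a # zs" using a by (meson split_list)
  have ne: "ys \<noteq> []" "zs \<noteq> []" using a split by auto
  have "(last ys, a) \<in> E" "(a, hd zs) \<in> E"
    using p ne unfolding split rel_path_def by (auto simp: successively_append_iff successively_Cons)
  moreover have "last ys \<noteq> hd zs"
  proof
    assume "last ys = hd zs"
    then have "hd zs \<in> set ys \<inter> set zs" using ne last_in_set[of ys] hd_in_set[of zs] by simp
    then show False using p unfolding split rel_path_def by auto
  qed
  ultimately show thesis
    using that[of "last ys" "hd zs"] ne E by (auto simp: split dest: symD)
qed

text \<open>Lengths of paths in \<open>S\<close> are bounded by its cardinality. The path is a
  longest one, and an end with a neighbour in \<open>S\<close> off the path would allow a longer
  one.\<close>

lemma rel_path_maximal:
  assumes E: "sym E" and p: "rel_path E p" "set p \<subseteq> S" and S: "finite S"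
  obtains q where "rel_path E q" "set p \<subseteq> set q" "set q \<subseteq> S"
    "\<And>a b. a \<in> set q \<Longrightarrow> (a, b) \<in> E \<Longrightarrow> b \<in> S - set q \<Longrightarrow> a \<noteq> hd q \<and> a \<noteq> last q"
proof -
  define P where "P q \<longleftrightarrow> rel_path E q \<and> set p \<subseteq> set q \<and> set q \<subseteq> S" for q
  have "length q < Suc (card S)" if "P q" for q
    using that card_mono[OF S, of "set q"] by (auto simp: P_def rel_path_def distinct_card)
  moreover have "P p" using p by (simp add: P_def)
  ultimately obtain q where q: "P q" and max: "\<And>q'. P q' \<Longrightarrow> length q' \<le> length q"
    using ex_has_greatest_nat[of P p length "Suc (card S)"] by blast
  show thesis
  proof (rule that[of q])
    fix a b assume ab: "a \<in> set q" "(a, b) \<in> E" "b \<in> S - set q"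
    show "a \<noteq> hd q \<and> a \<noteq> last q"
    proof (intro conjI notI)
      assume "a = hd q"
      then have "P (b # q)"
        using q ab E by (auto simp: P_def rel_path_def successively_Cons dest: symD)
      then show False using max by fastforce
    next
      assume "a = last q"
      then have "P (q @ [b])"
        using q ab by (auto simp: P_def rel_path_def successively_append_iff)
      then show False using max by fastforce
    qed
  qed (use q in \<open>auto simp: P_def\<close>)
qed

lemma card_ge_3I:
  assumes "finite A" "{x, y, z} \<subseteq> A" "x \<noteq> y" "y \<noteq> z" "x \<noteq> z"
  shows "card A \<ge> 3"
  using card_mono[OF assms(1,2)] assms(3-5) by simp

lemma card_ge_4I:
  assumes "finite A" "{w, x, y, z} \<subseteq> A" "distinct [w, x, y, z]"
  shows "card A \<ge> 4"
  using card_mono[OF assms(1,2)] assms(3) by simp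

lemma rtrancl_Restr_closed:
  assumes "(u, w) \<in> E\<^sup>*" "u \<in> K" "E `` K \<subseteq> K"
  shows "w \<in> K \<and> (u, w) \<in> (E \<inter> K \<times> K)\<^sup>*"
  using assms(1)
proof (induction rule: rtrancl_induct)
  case (step y z)
  then have "z \<in> K" "(y, z) \<in> E \<inter> K \<times> K" using assms(3) by auto
  with step show ?case by (meson rtrancl.rtrancl_into_rtrancl)
qed (use assms in auto)

text \<open>A maximal path outside all legs, together with the legs at its vertices of degree 3, is
  closed under adjacency and hence fills \<open>K\<close>. Any other edge leaving the path would
  start at an inner vertex: with its two path neighbours this vertex has degree 3, and its neighbour
  in the leg is then a fourth.\<close>

lemma legs_path_cover:
  fixes E :: "'a rel" and Leg :: "'a \<Rightarrow> 'a set"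
  assumes E: "sym E" and K: "finite K" "E `` K \<subseteq> K" "x0 \<in> K" "\<And>x. x \<in> K \<Longrightarrow> (x0, x) \<in> E\<^sup>*"
    and deg: "\<And>v. v \<in> K \<Longrightarrow> card (E `` {v}) \<le> 3"
    and leg_nbr: "\<And>v. v \<in> K \<Longrightarrow> card (E `` {v}) \<ge> 3 \<Longrightarrow> \<exists>z \<in> Leg v. (v, z) \<in> E"
    and leg_closed: "\<And>v z q. v \<in> K \<Longrightarrow> card (E `` {v}) \<ge> 3 \<Longrightarrow> z \<in> Leg v \<Longrightarrow> (z, q) \<in> E \<Longrightarrow> q \<in> Leg v \<or> q = v"
    and leg_deg: "\<And>v z. v \<in> K \<Longrightarrow> card (E `` {v}) \<ge> 3 \<Longrightarrow> z \<in> Leg v \<Longrightarrow> card (E `` {z}) < 3"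
  shows "\<exists>p. rel_path E p \<and> set p \<subseteq> K \<and> {v \<in> K. card (E `` {v}) \<ge> 3} \<subseteq> set p"
proof -
  define D where "D = {v \<in> K. card (E `` {v}) \<ge> 3}"
  define S where "S = K - (\<Union>v \<in> D. Leg v)"
  have fin: "finite (E `` {v})" if "v \<in> K" for v
    using K that by (meson finite_subset Image_singleton_iff ImageI subsetI subsetD)
  show ?thesis
  proof (cases "D = {}")
    case True
    then show ?thesis using K(3) by (intro exI[of _ "[x0]"]) (auto simp: rel_path_def D_def)
  next
    case False
    then obtain v0 where v0: "v0 \<in> D" by auto
    have "D \<subseteq> S" using leg_deg by (fastforce simp: S_def D_def)
    have "rel_path E [v0]" "set [v0] \<subseteq> S" using v0 \<open>D \<subseteq> S\<close> by (auto simp: rel_path_def)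
    from rel_path_maximal[OF E this] K(1) obtain q where q: "rel_path E q" "v0 \<in> set q" "set q \<subseteq> S" and
      max: "\<And>a b. a \<in> set q \<Longrightarrow> (a, b) \<in> E \<Longrightarrow> b \<in> S - set q \<Longrightarrow> a \<noteq> hd q \<and> a \<noteq> last q"
      by (auto simp: S_def)
    define W where "W = set q \<union> (\<Union>v \<in> D \<inter> set q. Leg v)"
    have closed: "b \<in> W" if ab: "a \<in> W" "a \<in> K" "(a, b) \<in> E" for a b
    proof -
      have "b \<in> K" using ab K by auto
      have ba: "(b, a) \<in> E" using ab E by (auto dest: symD)
      consider v where "v \<in> D" "v \<in> set q" "a \<in> Leg v" | "a \<in> set q" using ab by (auto simp: W_def)
      then show ?thesis
      proof cases
        case 1
        then show ?thesis using leg_closed[of v a b] ab by (auto simp: W_def D_def)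
      next
        case a: 2
        then have "a \<in> S" using q by auto
        show ?thesis
        proof (cases "b \<in> S")
          case False
          then obtain v where v: "v \<in> D" "b \<in> Leg v" using \<open>b \<in> K\<close> by (auto simp: S_def)
          then have "a = v" using leg_closed[of v b a] ba \<open>a \<in> S\<close> by (auto simp: S_def D_def)
          then show ?thesis using v a by (auto simp: W_def)
        next
          case True
          show ?thesis
          proof (rule ccontr)
            assume "b \<notin> W"
            then have "b \<notin> set q" by (auto simp: W_def)
            then have "a \<noteq> hd q" "a \<noteq> last q" using max[OF a ab(3)] True by auto
            then obtain x y where xy: "x \<in> set q" "y \<in> set q" "x \<noteq> y" "(a, x) \<in> E" "(a, y) \<in> E"
              using rel_path_inner[OF E q(1) a] by metis
            then have "card (E `` {a}) \<ge> 3"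
              using fin ab \<open>b \<notin> set q\<close> by (intro card_ge_3I[of _ x y b]) auto
            then have "a \<in> D" using ab by (simp add: D_def)
            then obtain z where z: "z \<in> Leg a" "(a, z) \<in> E" using leg_nbr by (auto simp: D_def)
            then have "z \<notin> S" using \<open>a \<in> D\<close> by (auto simp: S_def)
            then have "z \<noteq> x" "z \<noteq> y" "z \<noteq> b" using xy q True by auto
            then have "card (E `` {a}) \<ge> 4"
              using fin ab xy z \<open>b \<notin> set q\<close> by (intro card_ge_4I[of _ x y b z]) auto
            then show False using deg ab by fastforce
          qed
        qed
      qed
    qed
    have "x \<in> W" if "x \<in> K" for x
    proof -
      have "v0 \<in> K" using v0 by (simp add: D_def)
      then have "(v0, x) \<in> E\<^sup>*" using K(4) that E by (meson rtrancl_trans sym_rtrancl_swap)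
      then show ?thesis
      proof (induction rule: rtrancl_induct)
        case base
        then show ?case using q by (simp add: W_def)
      next
        case (step y z)
        then have "y \<in> K" using \<open>v0 \<in> K\<close> rtrancl_Restr_closed K(2) by metis
        then show ?case using closed step by blast
      qed
    qed
    \<comment> \<open>Members of \<open>D\<close> lie in \<open>S\<close>, outside all legs, so
      within \<open>W\<close> they can only be on the path itself.\<close>
    then have "D \<subseteq> set q" using \<open>D \<subseteq> S\<close> by (auto simp: W_def S_def D_def)
    then show ?thesis using q by (auto simp: D_def S_def)
  qed
qed

section \<open>Coordinates of a component around its spine\<close>

lemma rel_path_segment:
  assumes p: "rel_path E p" and "i < k" "k \<le> l" "l < length p"
  shows "(p ! k, p ! l) \<in> (E \<inter> (- {p ! i}) \<times> (- {p ! i}))\<^sup>*"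
  using assms(3,4)
proof (induction l rule: dec_induct)
  case (step l)
  have "(p ! l, p ! Suc l) \<in> E"
    using p step.prems by (auto simp: rel_path_def successively_conv_nth)
  moreover have "p ! l \<noteq> p ! i" "p ! Suc l \<noteq> p ! i"
    using p step assms(2) by (auto simp: rel_path_def nth_eq_iff_index_eq)
  ultimately show ?case using step by (auto intro: rtrancl_into_rtrancl)
qed auto

lemma rel_path_chordless:
  assumes E: "forest_rel E" and p: "rel_path E p" and ij: "i < j" "j < length p" "(p ! i, p ! j) \<in> E"
  shows "j = Suc i"
proof (rule ccontr)
  assume "j \<noteq> Suc i"
  then have "Suc i < j" using ij by simp
  have "(p ! i, p ! Suc i) \<in> E"
    using p ij by (auto simp: rel_path_def successively_conv_nth)
  moreover have "p ! Suc i \<noteq> p ! j"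
    using p ij \<open>j \<noteq> Suc i\<close> by (auto simp: rel_path_def nth_eq_iff_index_eq)
  ultimately show False
    using forest_rel_no_cycle[OF E _ ij(3)] rel_path_segment[OF p, of i "Suc i" j] ij \<open>Suc i < j\<close> by auto
qed

text \<open>The coordinates of the part \<open>W\<close> of a component placed so far. The last two
  clauses strengthen the induction: the spine is exactly the set at distance 0, and every other
  vertex has a predecessor towards it, which serves to identify the occupant of a position.\<close>

definition partial_coords :: "'a rel \<Rightarrow> 'a list \<Rightarrow> 'a set \<Rightarrow> ('a \<Rightarrow> nat) \<Rightarrow> ('a \<Rightarrow> nat) \<Rightarrow> bool" where
  "partial_coords E p W lev d \<longleftrightarrow>
     (\<forall>u \<in> W. \<forall>v \<in> W. (u, v) \<in> E \<longrightarrow>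
        lev u = lev v \<and> (d u = Suc (d v) \<or> d v = Suc (d u)) \<or>
        (lev u = Suc (lev v) \<or> lev v = Suc (lev u)) \<and> d u = 0 \<and> d v = 0) \<and>
     (\<forall>u \<in> W. \<forall>v \<in> W. lev u = lev v \<longrightarrow> d u = d v \<longrightarrow> u = v) \<and>
     (\<forall>v \<in> W. d v = 0 \<longleftrightarrow> v \<in> set p) \<and>
     (\<forall>v \<in> W. d v \<noteq> 0 \<longrightarrow> (\<exists>y \<in> W. (v, y) \<in> E \<and> lev y = lev v \<and> d v = Suc (d y)))"

lemma partial_coords_path:
  assumes E: "forest_rel E" and p: "rel_path E p"
  shows "\<exists>lev. partial_coords E p (set p) lev (\<lambda>_. 0)"
proof -
  have inj: "inj_on (\<lambda>i. p ! i) {..<length p}"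
    using p by (auto simp: rel_path_def inj_on_nth)
  define lev where "lev = the_inv_into {..<length p} (\<lambda>i. p ! i)"
  have lev: "lev (p ! i) = i" if "i < length p" for i
    using that the_inv_into_f_f[OF inj] by (simp add: lev_def)
  have "lev u = Suc (lev v) \<or> lev v = Suc (lev u)" if uv: "u \<in> set p" "v \<in> set p" "(u, v) \<in> E" for u v
  proof -
    obtain i j where i: "u = p ! i" "i < length p" and j: "v = p ! j" "j < length p"
      using uv by (metis in_set_conv_nth)
    have "(v, u) \<in> E" using uv E by (auto simp: forest_rel_def dest: symD)
    moreover have "i \<noteq> j" using forest_rel_irrefl[OF E uv(3)] i j by auto
    ultimately show ?thesis
      using rel_path_chordless[OF E p, of i j] rel_path_chordless[OF E p, of j i] i j uv lev
      by (cases "i < j") auto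
  qed
  moreover have "u = v" if "u \<in> set p" "v \<in> set p" "lev u = lev v" for u v
    using that lev by (metis in_set_conv_nth)
  ultimately show ?thesis
    by (intro exI[of _ lev]) (auto simp: partial_coords_def)
qed

text \<open>The new vertex continues the pendant path of \<open>a\<close>, and its position is free:
  an occupant would have \<open>a\<close> as predecessor. If \<open>a\<close> is on the path, the
  occupant, \<open>u\<close> and two path neighbours give it degree 4. If not, the occupant,
  \<open>u\<close> and the predecessor of \<open>a\<close> give it degree 3, against
  \<open>cover\<close>.\<close>

lemma partial_coords_extend:
  assumes E: "forest_rel E" and p: "rel_path E p" "set p \<subseteq> W" and fin: "finite (E `` {a})"
    and conn: "\<And>x y. x \<in> W \<Longrightarrow> y \<in> W \<Longrightarrow> (x, y) \<in> (E \<inter> W \<times> W)\<^sup>*"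
    and deg: "card (E `` {a}) \<le> 3" and cover: "card (E `` {a}) \<ge> 3 \<Longrightarrow> a \<in> set p"
    and inner: "a \<in> set p \<Longrightarrow> a \<noteq> hd p \<and> a \<noteq> last p"
    and au: "a \<in> W" "u \<notin> W" "(a, u) \<in> E"
    and W: "partial_coords E p W lev d"
  shows "partial_coords E p (insert u W) (lev(u := lev a)) (d(u := Suc (d a)))"
proof -
  have symE: "sym E" using E by (simp add: forest_rel_def)
  have ua: "(u, a) \<in> E" using au symE by (auto dest: symD)
  \<comment> \<open>\<open>W\<close> is connected without \<open>u\<close>, so a second neighbour of
    \<open>u\<close> in \<open>W\<close> would close a cycle.\<close>
  have only: "b = a" if b: "b \<in> W" "(u, b) \<in> E" for b
  proof (rule ccontr)
    assume "b \<noteq> a"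
    have "(E \<inter> W \<times> W)\<^sup>* \<subseteq> (E \<inter> (- {u}) \<times> (- {u}))\<^sup>*"
      using au by (intro rtrancl_mono) auto
    then have "(a, b) \<in> (E \<inter> (- {u}) \<times> (- {u}))\<^sup>*" using conn[of a b] au b by auto
    then show False using forest_rel_no_cycle[OF E ua b(2)] \<open>b \<noteq> a\<close> by auto
  qed
  have only': "b = a" if "b \<in> W" "(b, u) \<in> E" for b
    using only that symE by (auto dest: symD)
  have W1: "lev x = lev y \<and> (d x = Suc (d y) \<or> d y = Suc (d x)) \<or>
        (lev x = Suc (lev y) \<or> lev y = Suc (lev x)) \<and> d x = 0 \<and> d y = 0"
    if "x \<in> W" "y \<in> W" "(x, y) \<in> E" for x y
    using W that unfolding partial_coords_def by blast
  have W2: "x = y" if "x \<in> W" "y \<in> W" "lev x = lev y" "d x = d y" for x y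
    using W that unfolding partial_coords_def by blast
  have W3: "d x = 0 \<longleftrightarrow> x \<in> set p" if "x \<in> W" for x
    using W that unfolding partial_coords_def by blast
  have W4: "\<exists>y \<in> W. (x, y) \<in> E \<and> lev y = lev x \<and> d x = Suc (d y)" if "x \<in> W" "d x \<noteq> 0" for x
    using W that unfolding partial_coords_def by blast
  have free: False if x: "x \<in> W" "lev x = lev a" "d x = Suc (d a)" for x
  proof -
    obtain y where "y \<in> W" "(x, y) \<in> E" "lev y = lev x" "d x = Suc (d y)"
      using W4[of x] x by auto
    moreover from this have "y = a" using x au by (intro W2) auto
    ultimately have ax: "(a, x) \<in> E" using symE by (auto dest: symD)
    have "x \<noteq> u" using x au by auto
    show False
    proof (cases "a \<in> set p")
      case True
      then obtain y z where yz: "y \<in> set p" "z \<in> set p" "y \<noteq> z" "(a, y) \<in> E" "(a, z) \<in> E"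
        using rel_path_inner[OF symE p(1) True] inner by metis
      moreover have "x \<notin> set p" using W3[OF x(1)] x by simp
      ultimately have "card (E `` {a}) \<ge> 4"
        using fin ax au p(2) \<open>x \<noteq> u\<close> by (intro card_ge_4I[of _ x y z u]) auto
      then show False using deg by simp
    next
      case False
      then obtain y where "y \<in> W" "(a, y) \<in> E" "d a = Suc (d y)"
        using W4[of a] W3[of a] au by auto
      then have "card (E `` {a}) \<ge> 3"
        using fin ax au x \<open>x \<noteq> u\<close> by (intro card_ge_3I[of _ x y u]) auto
      then show False using cover False by simp
    qed
  qed
  have "u \<notin> set p" using au p by auto
  show ?thesis
    unfolding partial_coords_def
  proof (intro conjI ballI impI)
    fix x y assume "x \<in> insert u W" "y \<in> insert u W" "(x, y) \<in> E"
    then show "(lev(u := lev a)) x = (lev(u := lev a)) y \<and>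
        ((d(u := Suc (d a))) x = Suc ((d(u := Suc (d a))) y) \<or> (d(u := Suc (d a))) y = Suc ((d(u := Suc (d a))) x)) \<or>
        ((lev(u := lev a)) x = Suc ((lev(u := lev a)) y) \<or> (lev(u := lev a)) y = Suc ((lev(u := lev a)) x)) \<and>
        (d(u := Suc (d a))) x = 0 \<and> (d(u := Suc (d a))) y = 0"
      using W1[of x y] only[of y] only'[of x] forest_rel_irrefl[OF E] by (cases "x = u"; cases "y = u") auto
  next
    fix x y assume "x \<in> insert u W" "y \<in> insert u W" "(lev(u := lev a)) x = (lev(u := lev a)) y"
      "(d(u := Suc (d a))) x = (d(u := Suc (d a))) y"
    then show "x = y"
      using W2[of x y] free[of x] free[of y] by (cases "x = u"; cases "y = u") auto
  next
    fix x assume "x \<in> insert u W"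
    then show "(d(u := Suc (d a))) x = 0 \<longleftrightarrow> x \<in> set p"
      using W3 \<open>u \<notin> set p\<close> by auto
  next
    fix x assume x: "x \<in> insert u W" "(d(u := Suc (d a))) x \<noteq> 0"
    show "\<exists>y\<in>insert u W. (x, y) \<in> E \<and> (lev(u := lev a)) y = (lev(u := lev a)) x \<and>
        (d(u := Suc (d a))) x = Suc ((d(u := Suc (d a))) y)"
    proof (cases "x = u")
      case True
      then show ?thesis using ua au by (intro bexI[of _ a]) auto
    next
      case False
      then obtain y where "y \<in> W" "(x, y) \<in> E" "lev y = lev x" "d x = Suc (d y)"
        using W4[of x] x by auto
      then show ?thesis using False au by (intro bexI[of _ y]) auto
    qed
  qed
qed

lemma component_coords:
  assumes E: "forest_rel E" and K: "finite K" "E `` K \<subseteq> K" "\<And>x y. x \<in> K \<Longrightarrow> y \<in> K \<Longrightarrow> (x, y) \<in> E\<^sup>*"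
    and deg: "\<And>v. v \<in> K \<Longrightarrow> card (E `` {v}) \<le> 3"
    and p: "rel_path E p" "set p \<subseteq> K" "{v \<in> K. card (E `` {v}) \<ge> 3} \<subseteq> set p"
  shows "\<exists>lev d. coords (E \<inter> K \<times> K) lev d"
proof -
  have symE: "sym E" using E by (simp add: forest_rel_def)
  obtain q where q: "rel_path E q" "set p \<subseteq> set q" "set q \<subseteq> K" and
    max: "\<And>a b. a \<in> set q \<Longrightarrow> (a, b) \<in> E \<Longrightarrow> b \<in> K - set q \<Longrightarrow> a \<noteq> hd q \<and> a \<noteq> last q"
    by (rule rel_path_maximal[OF symE p(1,2) K(1)]) (rule that)
  \<comment> \<open>Connectivity inside \<open>W\<close> belongs to the invariant because it forces
    a new vertex to have a single neighbour in \<open>W\<close>.\<close>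
  define Q where "Q W \<longleftrightarrow> set q \<subseteq> W \<and> W \<subseteq> K \<and> (\<forall>x \<in> W. \<forall>y \<in> W. (x, y) \<in> (E \<inter> W \<times> W)\<^sup>*) \<and>
    (\<exists>lev d. partial_coords E q W lev d)" for W
  have "Q (set q)"
  proof -
    have "(q ! i, q ! j) \<in> (E \<inter> set q \<times> set q)\<^sup>*" if "i \<le> j" "j < length q" for i j
      using that
    proof (induction j rule: dec_induct)
      case (step n)
      have "(q ! n, q ! Suc n) \<in> E \<inter> set q \<times> set q"
        using q(1) step.prems by (auto simp: rel_path_def successively_conv_nth)
      then show ?case using step by (meson rtrancl.rtrancl_into_rtrancl Suc_lessD)
    qed auto
    moreover have "sym (E \<inter> set q \<times> set q)" using symE by (auto simp: sym_def)
    ultimately have "(q ! i, q ! j) \<in> (E \<inter> set q \<times> set q)\<^sup>*" if "i < length q" "j < length q" for i j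
      using that by (cases "i \<le> j") (auto intro: sym_rtrancl_swap)
    then have "\<forall>x \<in> set q. \<forall>y \<in> set q. (x, y) \<in> (E \<inter> set q \<times> set q)\<^sup>*"
      by (metis in_set_conv_nth)
    then show ?thesis using partial_coords_path[OF E q(1)] q(3) by (auto simp: Q_def)
  qed
  moreover have "card W < Suc (card K)" if "Q W" for W
    using that card_mono[OF K(1), of W] by (auto simp: Q_def)
  ultimately obtain W where W: "Q W" and Wmax: "\<And>W'. Q W' \<Longrightarrow> card W' \<le> card W"
    using ex_has_greatest_nat[of Q "set q" card "Suc (card K)"] by blast
  have finW: "finite W" using W K(1) finite_subset by (auto simp: Q_def)
  have "W = K"
  proof (rule ccontr)
    assume "W \<noteq> K"
    then obtain y where y: "y \<in> K" "y \<notin> W" using W by (auto simp: Q_def)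
    have hd: "hd q \<in> W" "hd q \<in> K" using W q by (auto simp: Q_def rel_path_def)
    then have "(hd q, y) \<in> E\<^sup>*" using K(3) y by blast
    have "\<not> E `` W \<subseteq> W"
    proof
      assume "E `` W \<subseteq> W"
      then have "y \<in> W" using rtrancl_Restr_closed[OF \<open>(hd q, y) \<in> E\<^sup>*\<close> hd(1)] by blast
      then show False using y by simp
    qed
    then obtain a u where au: "a \<in> W" "u \<notin> W" "(a, u) \<in> E" by auto
    have "a \<in> K" using au W by (auto simp: Q_def)
    then have "u \<in> K" using au K by auto
    obtain lev d where pc: "partial_coords E q W lev d" using W by (auto simp: Q_def)
    have conn: "(x, y) \<in> (E \<inter> W \<times> W)\<^sup>*" if "x \<in> W" "y \<in> W" for x y using W that by (simp add: Q_def)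
    have "partial_coords E q (insert u W) (lev(u := lev a)) (d(u := Suc (d a)))"
    proof (rule partial_coords_extend[OF E q(1) _ _ conn _ _ _ au pc])
      show "set q \<subseteq> W" using W by (simp add: Q_def)
      show "finite (E `` {a})" using K \<open>a \<in> K\<close> by (meson finite_subset Image_singleton_iff ImageI subsetI subsetD)
      show "card (E `` {a}) \<le> 3" using deg \<open>a \<in> K\<close> .
      show "a \<in> set q" if "card (E `` {a}) \<ge> 3" using that p(3) q(2) \<open>a \<in> K\<close> by auto
      \<comment> \<open>Maximality of the spine is used here: at one of its ends, two vertices off
        the spine could compete for the same position.\<close>
      show "a \<noteq> hd q \<and> a \<noteq> last q" if "a \<in> set q"
        using max[OF that au(3)] \<open>u \<in> K\<close> au W by (auto simp: Q_def)
    qed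
    moreover have "(x, y) \<in> (E \<inter> insert u W \<times> insert u W)\<^sup>*" if "x \<in> insert u W" "y \<in> insert u W" for x y
    proof -
      let ?R = "E \<inter> insert u W \<times> insert u W"
      have "(E \<inter> W \<times> W)\<^sup>* \<subseteq> ?R\<^sup>*" by (intro rtrancl_mono) auto
      then have in_W: "(x, y) \<in> ?R\<^sup>*" if "x \<in> W" "y \<in> W" for x y using conn that by blast
      have symR: "sym ?R" using symE by (auto simp: sym_def)
      have "(a, u) \<in> ?R" using au by auto
      then have to_a: "(a, x) \<in> ?R\<^sup>*" if "x \<in> insert u W" for x
        using that in_W[of a x] au by auto
      show ?thesis
        using rtrancl_trans[OF sym_rtrancl_swap[OF symR to_a[OF that(1)]] to_a[OF that(2)]] .
    qed
    ultimately have "Q (insert u W)"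
      using W \<open>u \<in> K\<close> unfolding Q_def by blast
    then show False using Wmax[of "insert u W"] au finW by simp
  qed
  then obtain lev d where pc: "partial_coords E q K lev d" using W by (auto simp: Q_def)
  have "u = w" if uw: "(u, w) \<in> (E \<inter> K \<times> K)\<^sup>*" "lev u = lev w" "d u = d w" for u w
  proof (cases "u = w")
    case False
    then have "u \<in> K" "w \<in> K" using uw(1) by (auto elim: rtranclE converse_rtranclE)
    then show ?thesis using pc uw unfolding partial_coords_def by blast
  qed
  then have "coords (E \<inter> K \<times> K) lev d"
    using pc unfolding coords_def partial_coords_def by blast
  then show ?thesis by blast
qed

lemma coords_from_components:
  assumes E: "sym E" and comp: "\<And>x. \<exists>lev d. coords (E \<inter> (E\<^sup>* `` {x}) \<times> (E\<^sup>* `` {x})) lev d"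
  shows "\<exists>lev d. coords E lev d"
proof -
  define C where "C x = E\<^sup>* `` {x}" for x
  have C_eq: "C x = C y" if "(x, y) \<in> E\<^sup>*" for x y
    using that sym_rtrancl_swap[OF E that] by (auto simp: C_def intro: rtrancl_trans)
  \<comment> \<open>The choice is indexed by components instead of vertices, so that all vertices of
    a component use the same pair of functions.\<close>
  have "\<forall>K. \<exists>ld. K \<in> range C \<longrightarrow> coords (E \<inter> K \<times> K) (fst ld) (snd ld)"
    using comp by (fastforce simp: C_def)
  then obtain f where f: "\<And>x. coords (E \<inter> C x \<times> C x) (fst (f (C x))) (snd (f (C x)))"
    by (metis rangeI)
  define lev where "lev v = fst (f (C v)) v" for v
  define d where "d v = snd (f (C v)) v" for v
  have "coords E lev d"
    unfolding coords_def
  proof (intro conjI allI impI)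
    fix u v assume uv: "(u, v) \<in> E"
    then have "C v = C u" using C_eq[of u v] by blast
    moreover have "(u, v) \<in> E \<inter> C u \<times> C u" using uv by (auto simp: C_def)
    ultimately show "lev u = lev v \<and> (d u = Suc (d v) \<or> d v = Suc (d u)) \<or>
        (lev u = Suc (lev v) \<or> lev v = Suc (lev u)) \<and> d u = 0 \<and> d v = 0"
      using coords_edge[OF f[of u], of u v] by (auto simp: lev_def d_def)
  next
    fix u w assume uw: "(u, w) \<in> E\<^sup>*" "lev u = lev w" "d u = d w"
    have "E `` C u \<subseteq> C u" by (auto simp: C_def intro: rtrancl_into_rtrancl)
    then have "(u, w) \<in> (E \<inter> C u \<times> C u)\<^sup>*"
      using rtrancl_Restr_closed[OF uw(1), of "C u"] by (auto simp: C_def)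
    then show "u = w"
      using coords_inj[OF f[of u]] uw C_eq[OF uw(1)] by (simp add: lev_def d_def)
  qed
  then show ?thesis by blast
qed

section \<open>Visibility of unit squares\<close>

text \<open>Disjoint squares met by a common line start at least 1 apart along it, so one of them
  obstructs the segment between two others exactly if its start lies between theirs. With
  \<open>s\<close> and \<open>t\<close> arbitrary, both directions are instances.\<close>

lemma visibility_band_iff_sees:
  fixes A B :: "'a \<Rightarrow> real" and S :: "'a \<Rightarrow> (real \<times> real) set"
  assumes onto: "\<And>a b. \<exists>p. s p = a \<and> t p = b"
    and S: "\<And>v. v \<in> V \<Longrightarrow> S v = {p. A v \<le> s p \<and> s p \<le> A v + 1 \<and> B v \<le> t p \<and> t p \<le> B v + 1}"
    and int: "\<And>v. v \<in> V \<Longrightarrow> interior (S v) = {p. A v < s p \<and> s p < A v + 1 \<and> B v < t p \<and> t p < B v + 1}"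
    and sep: "\<And>v w. v \<in> V \<Longrightarrow> w \<in> V \<Longrightarrow> v \<noteq> w \<Longrightarrow> \<bar>A v - A w\<bar> \<ge> 1 \<or> \<bar>B v - B w\<bar> \<ge> 1"
    and vw: "v \<in> V" "w \<in> V"
  shows "visibility_band s t V S v w \<longleftrightarrow> sees V B A v w"
proof -
  have meet: "{p. t p = c} \<inter> interior (S u) \<noteq> {} \<longleftrightarrow> c \<in> {B u<..<B u + 1}" if "u \<in> V" for u c
  proof
    assume "c \<in> {B u<..<B u + 1}"
    moreover obtain p where "s p = A u + 1/2" "t p = c" using onto by blast
    ultimately have "p \<in> {p. t p = c} \<inter> interior (S u)" using int[OF that] by auto
    then show "{p. t p = c} \<inter> interior (S u) \<noteq> {}" by blast
  qed (use int[OF that] in auto)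
  have after: "line_part_after s t (S u) (S u') c = {p. t p = c \<and> A u + 1 \<le> s p \<and> s p \<le> A u'}"
    if "u \<in> V" "u' \<in> V" "c \<in> {B u<..<B u + 1}" "c \<in> {B u'<..<B u' + 1}" for u u' c
  proof -
    obtain p where p: "s p = A u + 1" "t p = c" using onto by blast
    obtain p' where p': "s p' = A u'" "t p' = c" using onto by blast
    have "p \<in> S u" "p' \<in> S u'" using that p p' S by auto
    show ?thesis
    proof (intro set_eqI iffI)
      fix x assume "x \<in> line_part_after s t (S u) (S u') c"
      then show "x \<in> {p. t p = c \<and> A u + 1 \<le> s p \<and> s p \<le> A u'}"
        using \<open>p \<in> S u\<close> \<open>p' \<in> S u'\<close> p p' by (auto simp: line_part_after_def)
    next
      fix x assume "x \<in> {p. t p = c \<and> A u + 1 \<le> s p \<and> s p \<le> A u'}"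
      then show "x \<in> line_part_after s t (S u) (S u') c"
        unfolding line_part_after_def S[OF that(1)] S[OF that(2)] by auto
    qed
  qed
  have disj: "{p. t p = c \<and> A u + 1 \<le> s p \<and> s p \<le> A u'} \<inter> interior (S x) = {} \<longleftrightarrow>
      (c \<in> {B x<..<B x + 1} \<longrightarrow> \<not> (A u < A x \<and> A x < A u'))"
    if "u \<in> V" "u' \<in> V" "x \<in> V - {u, u'}" "c \<in> {B u<..<B u + 1}" "c \<in> {B u'<..<B u' + 1}" for u u' x c
  proof
    assume L: "{p. t p = c \<and> A u + 1 \<le> s p \<and> s p \<le> A u'} \<inter> interior (S x) = {}"
    show "c \<in> {B x<..<B x + 1} \<longrightarrow> \<not> (A u < A x \<and> A x < A u')"
    proof (intro impI notI)
      assume c: "c \<in> {B x<..<B x + 1}" and x: "A u < A x \<and> A x < A u'"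
      have "\<bar>A u - A x\<bar> \<ge> 1" "\<bar>A u' - A x\<bar> \<ge> 1"
        using sep[of u x] sep[of u' x] that c by auto
      moreover obtain p where "s p = A x + 1/2" "t p = c" using onto by blast
      ultimately have "p \<in> {p. t p = c \<and> A u + 1 \<le> s p \<and> s p \<le> A u'} \<inter> interior (S x)"
        using c x int[of x] that by auto
      then show False using L by blast
    qed
  next
    assume R: "c \<in> {B x<..<B x + 1} \<longrightarrow> \<not> (A u < A x \<and> A x < A u')"
    show "{p. t p = c \<and> A u + 1 \<le> s p \<and> s p \<le> A u'} \<inter> interior (S x) = {}"
      using R int[of x] that by auto
  qed
  have pointwise: "{p. t p = c} \<inter> interior (S v) \<noteq> {} \<and> {p. t p = c} \<inter> interior (S w) \<noteq> {} \<and>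
      (\<forall>u \<in> V - {v, w}. line_part_between s t (S v) (S w) c \<inter> interior (S u) = {}) \<longleftrightarrow>
      c \<in> {B v<..<B v + 1} \<and> c \<in> {B w<..<B w + 1} \<and>
        (\<forall>u \<in> V - {v, w}. c \<in> {B u<..<B u + 1} \<longrightarrow>
           \<not> (A v < A u \<and> A u < A w) \<and> \<not> (A w < A u \<and> A u < A v))" for c
  proof (cases "c \<in> {B v<..<B v + 1} \<and> c \<in> {B w<..<B w + 1}")
    case True
    have "line_part_between s t (S v) (S w) c \<inter> interior (S u) = {} \<longleftrightarrow>
      (c \<in> {B u<..<B u + 1} \<longrightarrow> \<not> (A v < A u \<and> A u < A w) \<and> \<not> (A w < A u \<and> A u < A v))"
      if "u \<in> V - {v, w}" for u
      using True vw that disj[of v w u c] disj[of w v u c]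
      unfolding line_part_between_def Int_Un_distrib2 Un_empty by (auto simp: after)
    then show ?thesis using True meet vw by simp
  next
    case False
    then show ?thesis using meet vw by blast
  qed
  show ?thesis
    unfolding visibility_band_def sees_def pointwise ..
qed

text \<open>To be applied to the ends of all squares: on the smaller interval the set of squares met
  by a line is constant.\<close>

lemma finite_avoiding_subinterval:
  fixes l r :: real
  assumes "finite F" "l < r"
  shows "\<exists>l' r'. l \<le> l' \<and> l' < r' \<and> r' \<le> r \<and> F \<inter> {l'<..<r'} = {}"
  using assms(1)
proof induction
  case empty
  then show ?case using assms(2) by auto
next
  case (insert x F)
  then obtain l' r' where lr: "l \<le> l'" "l' < r'" "r' \<le> r" "F \<inter> {l'<..<r'} = {}" by auto
  show ?case
  proof (cases "x \<in> {l'<..<r'}")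
    case True
    then show ?thesis using lr by (intro exI[of _ l'] exI[of _ x]) auto
  next
    case False
    then show ?thesis using lr by (intro exI[of _ l'] exI[of _ r']) auto
  qed
qed

text \<open>Three points pairwise at least 1 apart span at least 2, too much for the open interval
  of radius 1 around \<open>x\<close>.\<close>

lemma card_unit_separated:
  fixes t :: "'a \<Rightarrow> real"
  assumes "finite A" "\<And>w. w \<in> A \<Longrightarrow> \<bar>t w - x\<bar> < 1"
    and "\<And>v w. v \<in> A \<Longrightarrow> w \<in> A \<Longrightarrow> v \<noteq> w \<Longrightarrow> \<bar>t v - t w\<bar> \<ge> 1"
  shows "card A \<le> 2"
proof (rule ccontr)
  assume "\<not> card A \<le> 2"
  then obtain B where "B \<subseteq> A" "card B = 3" using obtain_subset_with_card_n[of 3 A] by auto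
  then obtain a b c where "a \<in> A" "b \<in> A" "c \<in> A" "a \<noteq> b" "b \<noteq> c" "a \<noteq> c"
    by (auto simp: card_3_iff)
  then show False
    using assms(2)[of a] assms(2)[of b] assms(2)[of c] assms(3)[of a b] assms(3)[of b c] assms(3)[of a c]
    by linarith
qed

text \<open>One direction of visibility. Of the disjointness of squares it keeps only that squares
  on a common line have distinct starts, which is what an order along the line requires and what
  survives reflection.\<close>

locale unit_bars =
  fixes V :: "'a set" and t s :: "'a \<Rightarrow> real" and E :: "'a rel"
  assumes fin: "finite V"
    and sep: "\<And>v w. v \<in> V \<Longrightarrow> w \<in> V \<Longrightarrow> v \<noteq> w \<Longrightarrow> \<bar>t v - t w\<bar> < 1 \<Longrightarrow> s v \<noteq> s w"
    and E_def: "E = {(v, w). v \<in> V \<and> w \<in> V \<and> v \<noteq> w \<and> sees V t s v w}"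
    and forest: "forest_rel E"
begin

lemma symE: "sym E"
  using forest by (simp add: forest_rel_def)

lemma edgeD:
  assumes "(v, w) \<in> E"
  shows "v \<in> V" "w \<in> V" "v \<noteq> w" "\<bar>t v - t w\<bar> < 1" "s v \<noteq> s w" "(w, v) \<in> E"
proof -
  show vw: "v \<in> V" "w \<in> V" "v \<noteq> w" and wv: "(w, v) \<in> E"
    using assms symE by (auto simp: E_def dest: symD)
  obtain l r where lr: "l < r" and "\<And>c. c \<in> {l<..<r} \<Longrightarrow> c \<in> {t v<..<t v + 1} \<and> c \<in> {t w<..<t w + 1}"
    using assms unfolding E_def sees_def by blast
  moreover obtain c where "c \<in> {l<..<r}" using dense[OF lr] by auto
  ultimately have "c \<in> {t v<..<t v + 1}" "c \<in> {t w<..<t w + 1}" by blast+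
  then show "\<bar>t v - t w\<bar> < 1" by auto
  then show "s v \<noteq> s w" using sep vw by blast
qed

text \<open>The bars met by a generic line are ordered by \<open>s\<close>, and consecutive ones see
  each other in a thin band around it. The lower bound on \<open>s\<close> is recorded in order to
  show that the chain avoids a bar further left.\<close>

lemma line_chain_less:
  assumes uw: "u \<in> V" "w \<in> V" "s u < s w" and lr: "l < r"
    and I: "\<And>c. c \<in> {l<..<r} \<Longrightarrow> c \<in> {t u<..<t u + 1} \<and> c \<in> {t w<..<t w + 1}"
  shows "\<exists>c \<in> {l<..<r}. (u, w) \<in> (E \<inter> {q. c \<in> {t q<..<t q + 1} \<and> s u \<le> s q} \<times> {q. c \<in> {t q<..<t q + 1} \<and> s u \<le> s q})\<^sup>*"
proof -
  have "finite (t ` V \<union> (\<lambda>q. t q + 1) ` V)" using fin by simp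
  from finite_avoiding_subinterval[OF this lr] obtain l' r' where
    lr': "l \<le> l'" "l' < r'" "r' \<le> r" and avoid: "(t ` V \<union> (\<lambda>q. t q + 1) ` V) \<inter> {l'<..<r'} = {}"
    by blast
  obtain c where c: "c \<in> {l'<..<r'}" using dense[OF lr'(2)] by auto
  have const: "c' \<in> {t q<..<t q + 1} \<longleftrightarrow> c \<in> {t q<..<t q + 1}" if "q \<in> V" "c' \<in> {l'<..<r'}" for q c'
  proof -
    have "t q \<notin> {l'<..<r'}" "t q + 1 \<notin> {l'<..<r'}" using avoid that by auto
    then show ?thesis using that c by auto
  qed
  define Q where "Q = {q \<in> V. c \<in> {t q<..<t q + 1}}"
  have "finite Q" using fin by (simp add: Q_def)
  have "(a, b) \<in> (E \<inter> {q \<in> Q. s a \<le> s q} \<times> {q \<in> Q. s a \<le> s q})\<^sup>*" if "a \<in> Q" "b \<in> Q" "s a < s b" for a b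
    using that
  proof (induction "card {q \<in> Q. s a < s q \<and> s q < s b}" arbitrary: a b rule: less_induct)
    case less
    show ?case
    proof (cases "{q \<in> Q. s a < s q \<and> s q < s b} = {}")
      case True
      have "sees V t s a b"
        unfolding sees_def
      proof (rule exI[of _ l'], rule exI[of _ r'], intro conjI ballI lr'(2))
        fix c' assume c': "c' \<in> {l'<..<r'}"
        show "c' \<in> {t a<..<t a + 1}" "c' \<in> {t b<..<t b + 1}"
          using less.prems const[OF _ c'] by (auto simp: Q_def)
        fix u assume "u \<in> V - {a, b}"
        then show "c' \<in> {t u<..<t u + 1} \<longrightarrow> \<not> (s a < s u \<and> s u < s b) \<and> \<not> (s b < s u \<and> s u < s a)"
          using True less.prems const[OF _ c', of u] by (auto simp: Q_def)
      qed
      then have "(a, b) \<in> E" using less.prems by (auto simp: E_def Q_def)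
      then show ?thesis using less.prems by auto
    next
      case False
      then obtain q where q: "q \<in> Q" "s a < s q" "s q < s b" by auto
      have "card {x \<in> Q. s a < s x \<and> s x < s q} < card {x \<in> Q. s a < s x \<and> s x < s b}"
        using q \<open>finite Q\<close> by (intro psubset_card_mono) auto
      then have "(a, q) \<in> (E \<inter> {x \<in> Q. s a \<le> s x} \<times> {x \<in> Q. s a \<le> s x})\<^sup>*"
        using less.hyps[of a q] less.prems q by blast
      moreover have "card {x \<in> Q. s q < s x \<and> s x < s b} < card {x \<in> Q. s a < s x \<and> s x < s b}"
        using q \<open>finite Q\<close> by (intro psubset_card_mono) auto
      then have "(q, b) \<in> (E \<inter> {x \<in> Q. s q \<le> s x} \<times> {x \<in> Q. s q \<le> s x})\<^sup>*"
        using less.hyps[of q b] less.prems q by blast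
      moreover have "(E \<inter> {x \<in> Q. s q \<le> s x} \<times> {x \<in> Q. s q \<le> s x})\<^sup>* \<subseteq>
          (E \<inter> {x \<in> Q. s a \<le> s x} \<times> {x \<in> Q. s a \<le> s x})\<^sup>*"
        using q by (intro rtrancl_mono) auto
      ultimately show ?thesis by (meson rtrancl_trans subsetD)
    qed
  qed
  moreover have "c \<in> {l<..<r}" using c lr' by auto
  moreover from this have "u \<in> Q" "w \<in> Q" using I uw by (auto simp: Q_def)
  ultimately have "(u, w) \<in> (E \<inter> {q \<in> Q. s u \<le> s q} \<times> {q \<in> Q. s u \<le> s q})\<^sup>*"
    using uw by blast
  moreover have "(E \<inter> {q \<in> Q. s u \<le> s q} \<times> {q \<in> Q. s u \<le> s q})\<^sup>* \<subseteq>
     (E \<inter> {q. c \<in> {t q<..<t q + 1} \<and> s u \<le> s q} \<times> {q. c \<in> {t q<..<t q + 1} \<and> s u \<le> s q})\<^sup>*"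
    by (intro rtrancl_mono) (auto simp: Q_def)
  ultimately show ?thesis using \<open>c \<in> {l<..<r}\<close> by blast
qed

lemma line_chain:
  assumes uw: "u \<in> V" "w \<in> V" and lr: "l < r"
    and I: "\<And>c. c \<in> {l<..<r} \<Longrightarrow> c \<in> {t u<..<t u + 1} \<and> c \<in> {t w<..<t w + 1}"
  shows "\<exists>c \<in> {l<..<r}. (u, w) \<in> (E \<inter> {q. c \<in> {t q<..<t q + 1} \<and> min (s u) (s w) \<le> s q} \<times>
    {q. c \<in> {t q<..<t q + 1} \<and> min (s u) (s w) \<le> s q})\<^sup>*"
proof -
  obtain c0 where c0: "c0 \<in> {l<..<r}" using dense[OF lr] by auto
  show ?thesis
  proof (cases "u = w")
    case True
    then show ?thesis using c0 by auto
  next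
    case False
    have "c0 \<in> {t u<..<t u + 1}" "c0 \<in> {t w<..<t w + 1}" using I c0 by blast+
    then have "\<bar>t u - t w\<bar> < 1" by auto
    then have "s u \<noteq> s w" using sep[OF uw False] by blast
    then consider "s u < s w" | "s w < s u" by linarith
    then show ?thesis
    proof cases
      case 1
      then show ?thesis using line_chain_less[OF uw 1 lr I] by simp
    next
      case 2
      have "\<And>c. c \<in> {l<..<r} \<Longrightarrow> c \<in> {t w<..<t w + 1} \<and> c \<in> {t u<..<t u + 1}" using I by blast
      from line_chain_less[OF uw(2,1) 2 lr this] obtain c where c: "c \<in> {l<..<r}" and
        wu: "(w, u) \<in> (E \<inter> {q. c \<in> {t q<..<t q + 1} \<and> s w \<le> s q} \<times> {q. c \<in> {t q<..<t q + 1} \<and> s w \<le> s q})\<^sup>*"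
        by blast
      have "(u, w) \<in> (E \<inter> {q. c \<in> {t q<..<t q + 1} \<and> s w \<le> s q} \<times>
          {q. c \<in> {t q<..<t q + 1} \<and> s w \<le> s q})\<^sup>*"
        by (rule sym_rtrancl_swap[OF _ wu]) (use symE in \<open>auto simp: sym_def\<close>)
      moreover have "min (s u) (s w) = s w" using 2 by simp
      ultimately show ?thesis using c by auto
    qed
  qed
qed

text \<open>The chain along a common line would use only bars that start at or after the first of
  \<open>a\<close> and \<open>b\<close>, hence would avoid \<open>v\<close> and close a
  cycle.\<close>

lemma right_nbrs_apart:
  assumes "(v, a) \<in> E" "(v, b) \<in> E" "s v < s a" "s v < s b" "a \<noteq> b"
  shows "\<bar>t a - t b\<bar> \<ge> 1"
proof (rule ccontr)
  assume "\<not> \<bar>t a - t b\<bar> \<ge> 1"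
  then have "max (t a) (t b) < min (t a + 1) (t b + 1)" by auto
  from line_chain[OF edgeD(2)[OF assms(1)] edgeD(2)[OF assms(2)] this] obtain c where
    "(a, b) \<in> (E \<inter> {q. c \<in> {t q<..<t q + 1} \<and> min (s a) (s b) \<le> s q} \<times>
      {q. c \<in> {t q<..<t q + 1} \<and> min (s a) (s b) \<le> s q})\<^sup>*"
    by auto
  moreover have "(E \<inter> {q. c \<in> {t q<..<t q + 1} \<and> min (s a) (s b) \<le> s q} \<times>
      {q. c \<in> {t q<..<t q + 1} \<and> min (s a) (s b) \<le> s q})\<^sup>* \<subseteq> (E \<inter> (- {v}) \<times> (- {v}))\<^sup>*"
    using assms by (intro rtrancl_mono) auto
  ultimately show False
    using forest_rel_no_cycle[OF forest assms(1,2,5)] by blast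
qed

text \<open>Only comparisons of \<open>s\<close> matter, and \<open>sees\<close> excludes
  obstruction in both orders, so negation may stand for reflection although the start of the
  reflected square is not \<open>- s v\<close>.\<close>

lemma mirror: "unit_bars V t (\<lambda>v. - s v) E"
proof
  have "sees V t (\<lambda>v. - s v) = sees V t s"
    unfolding sees_def fun_eq_iff by (simp add: conj_commute)
  then show "E = {(v, w). v \<in> V \<and> w \<in> V \<and> v \<noteq> w \<and> sees V t (\<lambda>v. - s v) v w}"
    using E_def by simp
qed (use fin sep forest in auto)

lemma left_nbrs_apart:
  assumes "(v, a) \<in> E" "(v, b) \<in> E" "s a < s v" "s b < s v" "a \<noteq> b"
  shows "\<bar>t a - t b\<bar> \<ge> 1"
  using unit_bars.right_nbrs_apart[OF mirror assms(1,2)] assms by simp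

text \<open>A line just beyond the border of \<open>v\<close> meets both neighbours and misses
  \<open>v\<close>, so the chain along it avoids \<open>v\<close>.\<close>

lemma offset_nbrs:
  assumes va: "(v, a) \<in> E" and vb: "(v, b) \<in> E" and "a \<noteq> b"
    and "t a < t v \<and> t b < t v \<or> t a > t v \<and> t b > t v"
  shows False
proof -
  have ta: "\<bar>t v - t a\<bar> < 1" "\<bar>t v - t b\<bar> < 1" and V: "a \<in> V" "b \<in> V"
    using edgeD[OF va] edgeD[OF vb] by auto
  obtain l r where lr: "l < r" "\<And>c. c \<in> {l<..<r} \<Longrightarrow> c \<in> {t a<..<t a + 1} \<and> c \<in> {t b<..<t b + 1}"
    "\<And>c. c \<in> {l<..<r} \<Longrightarrow> c \<notin> {t v<..<t v + 1}"
  proof (cases "t a < t v")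
    case True
    then show ?thesis using that[of "max (t a) (t b)" "t v"] assms ta by auto
  next
    case False
    then show ?thesis using that[of "t v + 1" "min (t a + 1) (t b + 1)"] assms ta by auto
  qed
  from line_chain[OF V lr(1,2)] obtain c where c: "c \<in> {l<..<r}" and
    "(a, b) \<in> (E \<inter> {q. c \<in> {t q<..<t q + 1} \<and> min (s a) (s b) \<le> s q} \<times>
      {q. c \<in> {t q<..<t q + 1} \<and> min (s a) (s b) \<le> s q})\<^sup>*" by blast
  moreover have "(E \<inter> {q. c \<in> {t q<..<t q + 1} \<and> min (s a) (s b) \<le> s q} \<times>
      {q. c \<in> {t q<..<t q + 1} \<and> min (s a) (s b) \<le> s q})\<^sup>* \<subseteq> (E \<inter> (- {v}) \<times> (- {v}))\<^sup>*"
    using lr(3)[OF c] by (intro rtrancl_mono) auto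
  ultimately show False
    using forest_rel_no_cycle[OF forest va vb \<open>a \<noteq> b\<close>] by blast
qed

text \<open>Two neighbours on the right already form a fork (\<open>right_forkI\<close>): they are
  at least 1 apart and each less than 1 from \<open>v\<close>, so they protrude on opposite
  sides.\<close>

definition right_fork :: "'a \<Rightarrow> bool" where
  "right_fork v \<longleftrightarrow> (\<exists>a b. (v, a) \<in> E \<and> (v, b) \<in> E \<and> s v < s a \<and> s v < s b \<and> t a < t v \<and> t v < t b)"

lemma right_forkI:
  assumes "(v, a) \<in> E" "(v, b) \<in> E" "s v < s a" "s v < s b" "a \<noteq> b"
  shows "right_fork v"
proof -
  have "\<bar>t a - t b\<bar> \<ge> 1" "\<bar>t v - t a\<bar> < 1" "\<bar>t v - t b\<bar> < 1"
    using right_nbrs_apart[OF assms] edgeD assms by auto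
  then consider "t a < t v" "t v < t b" | "t b < t v" "t v < t a" by linarith
  then show ?thesis using assms by (cases; unfold right_fork_def; blast)
qed

text \<open>A neighbour not aligned with \<open>v\<close> would protrude on the same side as one
  prong of the fork.\<close>

lemma right_fork_left_nbr:
  assumes "right_fork v" "(v, z) \<in> E" "s z < s v"
  shows "t z = t v"
proof -
  obtain a b where ab: "(v, a) \<in> E" "(v, b) \<in> E" "s v < s a" "s v < s b" "t a < t v" "t v < t b"
    using assms by (auto simp: right_fork_def)
  have "z \<noteq> a" "z \<noteq> b" using ab assms by auto
  then show ?thesis
    using offset_nbrs[OF assms(2) ab(1)] offset_nbrs[OF assms(2) ab(2)] ab by force
qed

text \<open>The squares aligned behind a fork form a pendant path of the visibility graph.\<close>

lemma right_fork_leg_closed: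
  assumes v: "v \<in> V" "right_fork v" and z: "z \<in> V" "t z = t v" "s z < s v" and zq: "(z, q) \<in> E"
  shows "q = v \<or> t q = t v \<and> s q < s v"
proof -
  obtain a b where ab: "(v, a) \<in> E" "(v, b) \<in> E" "s v < s a" "s v < s b" "t a < t v" "t v < t b"
    using v by (auto simp: right_fork_def)
  have q: "q \<in> V" "q \<noteq> z" "\<bar>t z - t q\<bar> < 1" using edgeD[OF zq] by auto
  have "v \<noteq> z" using z by auto
  consider "t q = t v" | "t q \<noteq> t v" by blast
  then show ?thesis
  proof cases
    case 1
    \<comment> \<open>An aligned \<open>q\<close> beyond \<open>v\<close> would be hidden from
      \<open>z\<close> by \<open>v\<close>.\<close>
    have "\<not> s q > s v"
    proof
      assume qv: "s q > s v"
      from zq obtain l r where "l < r" and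
        clear: "\<And>c. c \<in> {l<..<r} \<Longrightarrow> c \<in> {t z<..<t z + 1} \<and>
          (\<forall>u \<in> V - {z, q}. c \<in> {t u<..<t u + 1} \<longrightarrow> \<not> (s z < s u \<and> s u < s q))"
        unfolding E_def sees_def by blast
      obtain c where "c \<in> {l<..<r}" using dense[OF \<open>l < r\<close>] by auto
      from clear[OF this] show False using v z qv by auto
    qed
    then show ?thesis using sep[OF q(1) v(1)] 1 by force
  next
    case 2
    \<comment> \<open>The prong \<open>w\<close> protrudes on the side of \<open>q\<close>. This
      gives a second route from \<open>z\<close> to \<open>q\<close>: along a line through
      \<open>z\<close> and \<open>v\<close> missing \<open>q\<close>, over the edge to
      \<open>w\<close>, and along a line through \<open>w\<close> and \<open>q\<close> missing
      \<open>v\<close> and thus the aligned \<open>z\<close>.\<close>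
    obtain w where w: "(v, w) \<in> E" "t w < t v \<and> t q < t v \<or> t w > t v \<and> t q > t v"
      using ab 2 by (cases "t q < t v") auto
    have wV: "w \<in> V" "\<bar>t v - t w\<bar> < 1" using edgeD[OF w(1)] by auto
    obtain l r where lr: "l < r" "\<And>c. c \<in> {l<..<r} \<Longrightarrow> c \<in> {t w<..<t w + 1} \<and> c \<in> {t q<..<t q + 1}"
      "\<And>c. c \<in> {l<..<r} \<Longrightarrow> c \<notin> {t v<..<t v + 1}"
    proof (cases "t q < t v")
      case True
      then show ?thesis using that[of "max (t w) (t q)" "t v"] w wV q z by auto
    next
      case False
      then show ?thesis using that[of "t v + 1" "min (t w + 1) (t q + 1)"] w wV q z by auto
    qed
    obtain l' r' where lr': "l' < r'" "\<And>c. c \<in> {l'<..<r'} \<Longrightarrow> c \<in> {t z<..<t z + 1} \<and> c \<in> {t v<..<t v + 1}"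
      "\<And>c. c \<in> {l'<..<r'} \<Longrightarrow> c \<notin> {t q<..<t q + 1}"
    proof (cases "t q < t v")
      case True
      then show ?thesis using that[of "t q + 1" "t v + 1"] q z by auto
    next
      case False
      then show ?thesis using that[of "t v" "t q"] q z 2 by auto
    qed
    let ?D = "E - {(z, q), (q, z)}"
    obtain c where c: "c \<in> {l<..<r}" and
      "(w, q) \<in> (E \<inter> {x. c \<in> {t x<..<t x + 1} \<and> min (s w) (s q) \<le> s x} \<times>
        {x. c \<in> {t x<..<t x + 1} \<and> min (s w) (s q) \<le> s x})\<^sup>*"
      using line_chain[OF wV(1) q(1) lr(1,2)] by blast
    moreover have "(E \<inter> {x. c \<in> {t x<..<t x + 1} \<and> min (s w) (s q) \<le> s x} \<times>
        {x. c \<in> {t x<..<t x + 1} \<and> min (s w) (s q) \<le> s x})\<^sup>* \<subseteq> ?D\<^sup>*"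
      using lr(3)[OF c] z by (intro rtrancl_mono) auto
    ultimately have "(w, q) \<in> ?D\<^sup>*" by blast
    obtain c' where c': "c' \<in> {l'<..<r'}" and
      "(z, v) \<in> (E \<inter> {x. c' \<in> {t x<..<t x + 1} \<and> min (s z) (s v) \<le> s x} \<times>
        {x. c' \<in> {t x<..<t x + 1} \<and> min (s z) (s v) \<le> s x})\<^sup>*"
      using line_chain[OF z(1) v(1) lr'(1,2)] by blast
    moreover have "(E \<inter> {x. c' \<in> {t x<..<t x + 1} \<and> min (s z) (s v) \<le> s x} \<times>
        {x. c' \<in> {t x<..<t x + 1} \<and> min (s z) (s v) \<le> s x})\<^sup>* \<subseteq> ?D\<^sup>*"
      using lr'(3)[OF c'] by (intro rtrancl_mono) auto
    ultimately have "(z, v) \<in> ?D\<^sup>*" by blast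
    moreover have "(v, w) \<in> ?D" using w \<open>v \<noteq> z\<close> 2 by auto
    ultimately have "(z, q) \<in> ?D\<^sup>*"
      using \<open>(w, q) \<in> ?D\<^sup>*\<close> by (meson rtrancl.rtrancl_into_rtrancl rtrancl_trans)
    then show ?thesis using forest zq by (auto simp: forest_rel_def)
  qed
qed

section \<open>Degrees and legs in one direction of visibility\<close>

definition right_nbrs :: "'a \<Rightarrow> 'a set" where
  "right_nbrs v = {w. (v, w) \<in> E \<and> s v < s w}"

definition left_nbrs :: "'a \<Rightarrow> 'a set" where
  "left_nbrs v = {w. (v, w) \<in> E \<and> s w < s v}"

lemma nbrs_split: "E `` {v} = right_nbrs v \<union> left_nbrs v" "right_nbrs v \<inter> left_nbrs v = {}"
  using edgeD(5) by (force simp: right_nbrs_def left_nbrs_def)+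

lemma finite_nbrs: "finite (right_nbrs v)" "finite (left_nbrs v)"
  by (rule finite_subset[OF _ fin]; auto simp: right_nbrs_def left_nbrs_def dest: edgeD)+

lemma card_nbrs: "card (E `` {v}) = card (right_nbrs v) + card (left_nbrs v)"
  unfolding nbrs_split(1) by (intro card_Un_disjoint finite_nbrs nbrs_split)

lemma card_right_nbrs: "card (right_nbrs v) \<le> 2"
  by (rule card_unit_separated[of _ t "t v", OF finite_nbrs(1)])
    (use right_nbrs_apart edgeD(4) in \<open>force simp: right_nbrs_def\<close>)+

lemma card_left_nbrs: "card (left_nbrs v) \<le> 2"
  by (rule card_unit_separated[of _ t "t v", OF finite_nbrs(2)])
    (use left_nbrs_apart edgeD(4) in \<open>force simp: left_nbrs_def\<close>)+

lemma right_fork_iff: "right_fork v \<longleftrightarrow> card (right_nbrs v) = 2"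
proof
  assume "right_fork v"
  then obtain a b where "{a, b} \<subseteq> right_nbrs v" "a \<noteq> b" by (force simp: right_fork_def right_nbrs_def)
  then show "card (right_nbrs v) = 2"
    using card_mono[OF finite_nbrs(1), of "{a, b}" v] card_right_nbrs[of v] by simp
next
  assume "card (right_nbrs v) = 2"
  then obtain a b where "right_nbrs v = {a, b}" "a \<noteq> b" by (auto simp: card_2_iff)
  then show "right_fork v" by (intro right_forkI[of v a b]) (auto simp: right_nbrs_def)
qed

lemma right_fork_card_left: 
  assumes "right_fork v"
  shows "card (left_nbrs v) \<le> 1"
proof (rule ccontr)
  assume "\<not> card (left_nbrs v) \<le> 1"
  then have "card (left_nbrs v) = 2" using card_left_nbrs[of v] by simp
  then obtain a b where "left_nbrs v = {a, b}" "a \<noteq> b" by (auto simp: card_2_iff)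
  then have ab: "(v, a) \<in> E" "(v, b) \<in> E" "s a < s v" "s b < s v" "a \<noteq> b"
    by (auto simp: left_nbrs_def)
  then show False
    using left_nbrs_apart[OF ab] right_fork_left_nbr[OF assms] by force
qed

text \<open>Neighbours on the same side are at least 1 apart, so at most one on each side is aligned
  with \<open>z\<close>.\<close>

lemma aligned_degree:
  assumes "\<And>q. (z, q) \<in> E \<Longrightarrow> t q = t z"
  shows "card (E `` {z}) < 3"
proof -
  have "card (right_nbrs z) \<le> 1"
  proof (rule ccontr)
    assume "\<not> card (right_nbrs z) \<le> 1"
    then have "card (right_nbrs z) = 2" using card_right_nbrs[of z] by simp
    then obtain a b where "(z, a) \<in> E" "t a < t z" by (auto simp: right_fork_iff[symmetric] right_fork_def)
    then show False using assms by fastforce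
  qed
  moreover have "card (left_nbrs z) \<le> 1"
  proof (rule ccontr)
    assume "\<not> card (left_nbrs z) \<le> 1"
    then have "card (left_nbrs z) = 2" using card_left_nbrs[of z] by simp
    then obtain a b where "left_nbrs z = {a, b}" "a \<noteq> b" by (auto simp: card_2_iff)
    then have ab: "(z, a) \<in> E" "(z, b) \<in> E" "s a < s z" "s b < s z" "a \<noteq> b"
      by (auto simp: left_nbrs_def)
    then show False
      using left_nbrs_apart[OF ab] assms by force
  qed
  ultimately show ?thesis using card_nbrs[of z] by simp
qed

text \<open>Meant for vertices of degree 3, which by \<open>left_fork\<close> fork to the left if
  they do not fork to the right.\<close>

definition leg :: "'a \<Rightarrow> 'a set" where
  "leg v = {z \<in> V. t z = t v \<and> (if right_fork v then s z < s v else s v < s z)}"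

lemma degree_le_3: "card (E `` {v}) \<le> 3"
  using card_nbrs[of v] card_right_nbrs[of v] card_left_nbrs[of v] right_fork_card_left[of v]
  by (cases "right_fork v") (auto simp: right_fork_iff)

lemma left_fork:
  assumes "card (E `` {v}) \<ge> 3" "\<not> right_fork v"
  shows "unit_bars.right_fork (\<lambda>v. t v) (\<lambda>v. - s v) E v" "card (right_nbrs v) = 1"
proof -
  interpret M: unit_bars V t "\<lambda>v. - s v" E by (rule mirror)
  have "card (left_nbrs v) = 2" "card (right_nbrs v) = 1"
    using assms card_nbrs[of v] card_right_nbrs[of v] card_left_nbrs[of v] by (auto simp: right_fork_iff)
  moreover have "M.right_nbrs v = left_nbrs v"
    by (auto simp: M.right_nbrs_def left_nbrs_def)
  ultimately show "M.right_fork v" "card (right_nbrs v) = 1" by (simp_all add: M.right_fork_iff)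
qed

lemma leg_nbr:
  assumes "card (E `` {v}) \<ge> 3"
  shows "\<exists>z \<in> leg v. (v, z) \<in> E"
proof (cases "right_fork v")
  case True
  have "card (left_nbrs v) \<noteq> 0"
    using assms card_nbrs[of v] True by (auto simp: right_fork_iff)
  then obtain z where "z \<in> left_nbrs v" by (metis card.empty ex_in_conv)
  then have z: "(v, z) \<in> E" "s z < s v" by (auto simp: left_nbrs_def)
  then show ?thesis
    using right_fork_left_nbr[OF True z] edgeD[OF z(1)] True by (auto simp: leg_def)
next
  case False
  interpret M: unit_bars V t "\<lambda>v. - s v" E by (rule mirror)
  have "card (right_nbrs v) \<noteq> 0" using left_fork[OF assms False] by simp
  then obtain z where "z \<in> right_nbrs v" by (metis card.empty ex_in_conv)
  then have z: "(v, z) \<in> E" "s v < s z" by (auto simp: right_nbrs_def)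
  then show ?thesis
    using M.right_fork_left_nbr[OF left_fork(1)[OF assms False] z(1)] edgeD[OF z(1)] False
    by (auto simp: leg_def)
qed

lemma leg_closed:
  assumes "v \<in> V" "card (E `` {v}) \<ge> 3" "z \<in> leg v" "(z, q) \<in> E"
  shows "q \<in> leg v \<or> q = v"
proof (cases "right_fork v")
  case True
  then show ?thesis
    using right_fork_leg_closed[OF assms(1) True _ _ _ assms(4)] edgeD[OF assms(4)] assms(3)
    by (auto simp: leg_def)
next
  case False
  interpret M: unit_bars V t "\<lambda>v. - s v" E by (rule mirror)
  show ?thesis
    using M.right_fork_leg_closed[OF assms(1) left_fork(1)[OF assms(2) False] _ _ _ assms(4)]
      edgeD[OF assms(4)] assms(3) False
    by (auto simp: leg_def)
qed

lemma leg_degree: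
  assumes "v \<in> V" "card (E `` {v}) \<ge> 3" "z \<in> leg v"
  shows "card (E `` {z}) < 3"
  using leg_closed[OF assms] assms(3) by (intro aligned_degree) (auto simp: leg_def)

lemma path_cover:
  assumes "x0 \<in> V"
  shows "\<exists>p. rel_path E p \<and> set p \<subseteq> E\<^sup>* `` {x0} \<and> {v \<in> E\<^sup>* `` {x0}. card (E `` {v}) \<ge> 3} \<subseteq> set p"
proof (rule legs_path_cover[OF symE, of _ x0 leg])
  have sub: "E\<^sup>* `` {x0} \<subseteq> V"
    using assms by (auto elim: rtranclE dest: edgeD)
  then show "finite (E\<^sup>* `` {x0})" using fin by (rule finite_subset)
  show "E `` E\<^sup>* `` {x0} \<subseteq> E\<^sup>* `` {x0}" by (auto intro: rtrancl_into_rtrancl)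
  show "x0 \<in> E\<^sup>* `` {x0}" by simp
  show "(x0, x) \<in> E\<^sup>*" if "x \<in> E\<^sup>* `` {x0}" for x using that by simp
  show "card (E `` {v}) \<le> 3" for v by (rule degree_le_3)
  show "\<exists>z \<in> leg v. (v, z) \<in> E" if "card (E `` {v}) \<ge> 3" for v using leg_nbr[OF that] .
  show "q \<in> leg v \<or> q = v" if "v \<in> E\<^sup>* `` {x0}" "card (E `` {v}) \<ge> 3" "z \<in> leg v" "(z, q) \<in> E" for v z q
    using leg_closed[of v z q] that sub by blast
  show "card (E `` {z}) < 3" if "v \<in> E\<^sup>* `` {x0}" "card (E `` {v}) \<ge> 3" "z \<in> leg v" for v z
    using leg_degree[of v z] that sub by blast
qed

end

section \<open>Subdivided caterpillars\<close>

lemma out_degree_with_proj: "out_degree (with_proj G) v = card (parcs G `` {v})"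
proof -
  have "out_arcs (with_proj G) v = Pair v ` (parcs G `` {v})"
    by (auto simp: out_arcs_def)
  then show ?thesis
    by (simp add: out_degree_def card_image inj_on_def)
qed

lemma set_vwalk_arcs_subset_iff: "set (vwalk_arcs p) \<subseteq> E \<longleftrightarrow> successively (\<lambda>a b. (a, b) \<in> E) p"
  by (induction p rule: vwalk_arcs.induct) auto

lemma vpath_iff_rel_path: "vpath p (with_proj G) \<longleftrightarrow> rel_path (parcs G) p \<and> set p \<subseteq> pverts G"
  by (auto simp: vpath_def vwalk_def rel_path_def set_vwalk_arcs_subset_iff)

lemma pair_graphI:
  assumes "finite V" "E \<subseteq> V \<times> V" "sym E" "\<And>v. (v, v) \<notin> E"
  shows "pair_graph \<lparr>pverts = V, parcs = E\<rparr>"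
proof -
  have "finite E" using assms by (meson finite_SigmaI finite_subset)
  then show ?thesis
    using assms by unfold_locales (auto simp: symmetric_def)
qed

lemma undirected_tree_iff:
  "undirected_tree G \<longleftrightarrow> pair_graph G \<and> forest_rel (parcs G) \<and> pverts G \<noteq> {} \<and>
     (\<forall>u \<in> pverts G. \<forall>v \<in> pverts G. (u, v) \<in> (parcs G)\<^sup>*)"
proof (cases "pair_graph G")
  case True
  then interpret pair_graph G .
  have "(\<Union>e \<in> parcs G. {(fst e, snd e), (snd e, fst e)}) = parcs G"
    using arcs_symmetric by force
  then have "with_proj (mk_symmetric (with_proj G)) = with_proj G"
    by (simp add: mk_symmetric_def with_proj_def)
  then have "Digraph_Component.connected (with_proj G) \<longleftrightarrow> strongly_connected (with_proj G)"
    by (simp add: connected_def)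
  also have "\<dots> \<longleftrightarrow> pverts G \<noteq> {} \<and> (\<forall>u \<in> pverts G. \<forall>v \<in> pverts G. (u, v) \<in> (parcs G)\<^sup>*)"
    using reachable_conv' by (auto simp: strongly_connected_def)
  finally show ?thesis
    using True by (simp add: undirected_tree_def undirected_forest_iff)
qed (simp add: undirected_tree_def undirected_forest_iff)

lemma sccs_pair_graph:
  assumes "pair_graph F"
  shows "with_proj C \<in> pre_digraph.sccs (with_proj F) \<longleftrightarrow>
    (\<exists>x \<in> pverts F. C = \<lparr>pverts = (parcs F)\<^sup>* `` {x},
       parcs = parcs F \<inter> ((parcs F)\<^sup>* `` {x}) \<times> ((parcs F)\<^sup>* `` {x})\<rparr>)"
proof -
  interpret pair_graph F by fact
  have scc: "scc_of x = (parcs F)\<^sup>* `` {x}" if x: "x \<in> pverts F" for x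
  proof -
    have "scc_of x = {v. x \<rightarrow>\<^sup>*\<^bsub>with_proj F\<^esub> v}"
      by (auto simp: scc_of_def intro: symmetric_reachable')
    then show ?thesis using reachable_conv'[OF x] by auto
  qed
  have induce: "with_proj F \<restriction> K = with_proj \<lparr>pverts = K, parcs = parcs F \<inter> K \<times> K\<rparr>" for K
    by (auto simp: induce_subgraph_def with_proj_def)
  have "sccs = (\<lambda>x. with_proj F \<restriction> scc_of x) ` pverts F"
    unfolding sccs_conv_sccs_verts sccs_verts_conv_scc_of image_image ..
  also have "\<dots> = (\<lambda>x. with_proj \<lparr>pverts = (parcs F)\<^sup>* `` {x},
       parcs = parcs F \<inter> ((parcs F)\<^sup>* `` {x}) \<times> ((parcs F)\<^sup>* `` {x})\<rparr>) ` pverts F"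
    by (rule image_cong) (simp_all add: scc induce)
  finally have sccs: "sccs = (\<lambda>x. with_proj \<lparr>pverts = (parcs F)\<^sup>* `` {x},
       parcs = parcs F \<inter> ((parcs F)\<^sup>* `` {x}) \<times> ((parcs F)\<^sup>* `` {x})\<rparr>) ` pverts F" .
  have inj: "with_proj C = with_proj C' \<longleftrightarrow> C = C'" for C C' :: "'a pair_pre_digraph"
    by (auto simp: with_proj_def)
  show ?thesis
    unfolding sccs by (auto simp: inj)
qed

lemma successively_subdivide:
  assumes "successively (\<lambda>a b. (a, b) \<in> E) q" "\<not> {u, v} \<subseteq> set q" "E' = E - {(u, v), (v, u)} \<union> X"
  shows "successively (\<lambda>a b. (a, b) \<in> E') q"
  by (rule successively_mono[OF assms(1)]) (use assms(2,3) in auto)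

text \<open>If the path runs through the subdivided edge, \<open>w\<close> is inserted there; each
  half contains only one end of the edge and does not notice its removal.\<close>

lemma rel_path_subdivide:
  assumes p: "rel_path E p" and w: "w \<notin> set p"
    and E': "E' = E - {(u, v), (v, u)} \<union> {(u, w), (w, u), (w, v), (v, w)}"
  shows "\<exists>q. rel_path E' q \<and> set p \<subseteq> set q \<and> set q \<subseteq> insert w (set p)"
proof (cases "\<exists>xs x y ys. p = xs @ x # y # ys \<and> {x, y} = {u, v}")
  case True
  then obtain xs x y ys where split: "p = xs @ x # y # ys" and xy: "{x, y} = {u, v}" by blast
  have dist: "distinct p" and suc: "successively (\<lambda>a b. (a, b) \<in> E) p"
    using p by (auto simp: rel_path_def)
  have "successively (\<lambda>a b. (a, b) \<in> E) (xs @ [x])" "successively (\<lambda>a b. (a, b) \<in> E) (y # ys)"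
    using suc unfolding split by (auto simp: successively_append_iff successively_Cons)
  moreover have "\<not> {u, v} \<subseteq> set (xs @ [x])" "\<not> {u, v} \<subseteq> set (y # ys)"
    using dist xy unfolding split by auto
  ultimately have suc': "successively (\<lambda>a b. (a, b) \<in> E') (xs @ [x])" "successively (\<lambda>a b. (a, b) \<in> E') (y # ys)"
    using successively_subdivide E' by metis+
  have "(x, w) \<in> E'" "(w, y) \<in> E'" using xy E' by (auto simp: doubleton_eq_iff)
  then have "successively (\<lambda>a b. (a, b) \<in> E') (xs @ x # w # y # ys)"
    using suc' by (auto simp: successively_append_iff successively_Cons)
  then have "rel_path E' (xs @ x # w # y # ys)"
    using dist w unfolding split rel_path_def by auto
  then show ?thesis
    by (intro exI[of _ "xs @ x # w # y # ys"]) (auto simp: split)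
next
  case False
  have "successively (\<lambda>a b. (a, b) \<in> E') p"
    unfolding successively_conv_nth
  proof (intro allI impI)
    fix i assume i: "Suc i < length p"
    have "p = take i p @ p ! i # p ! Suc i # drop (Suc (Suc i)) p"
      using i by (simp add: Cons_nth_drop_Suc)
    then have "{p ! i, p ! Suc i} \<noteq> {u, v}" using False by blast
    moreover have "(p ! i, p ! Suc i) \<in> E"
      using p i by (auto simp: rel_path_def successively_conv_nth)
    ultimately show "(p ! i, p ! Suc i) \<in> E'" unfolding E' by blast
  qed
  then show ?thesis using p by (intro exI[of _ p]) (auto simp: rel_path_def)
qed

text \<open>The property survives each subdivision step: the path is rerouted through the new vertex
  if necessary, this vertex has degree at most 2, and no other degree grows.\<close>

lemma subdivided_caterpillar_path_cover:
  assumes "subdivided_caterpillar H"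
  shows "\<exists>p. rel_path (parcs H) p \<and> set p \<subseteq> pverts H \<and> {v \<in> pverts H. card (parcs H `` {v}) \<ge> 3} \<subseteq> set p"
proof -
  obtain G where G: "caterpillar G" "subdivision_pair G H"
    using assms by (auto simp: subdivided_caterpillar_def)
  have pg: "pair_graph G" using G(1) by (simp add: caterpillar_def undirected_tree_iff)
  from G(2) show ?thesis
  proof (induction rule: subdivision_pair_induct)
    case base
    from G(1) obtain p where "vpath p (with_proj G)"
      "{v \<in> pverts G. out_degree (with_proj G) v > 1} \<subseteq> set p" by (auto simp: caterpillar_def)
    then show ?case
      by (intro exI[of _ p]) (auto simp: vpath_iff_rel_path out_degree_with_proj)
  next
    case (divide e w H)
    obtain u v where e: "e = (u, v)" by (cases e)
    interpret H: pair_graph H using pair_graph.pair_graph_subdivision[OF pg divide(3)] .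
    obtain p where p: "rel_path (parcs H) p" "set p \<subseteq> pverts H"
      "{v \<in> pverts H. card (parcs H `` {v}) \<ge> 3} \<subseteq> set p" using divide.IH by blast
    let ?E' = "parcs (subdivide H e w)"
    have E': "?E' = parcs H - {(u, v), (v, u)} \<union> {(u, w), (w, u), (w, v), (v, w)}" by (simp add: e)
    have "w \<notin> set p" using p divide by auto
    from rel_path_subdivide[OF p(1) this E'] obtain q where
      q: "rel_path ?E' q" "set p \<subseteq> set q" "set q \<subseteq> insert w (set p)" by blast
    have uv: "(u, v) \<in> parcs H" "(v, u) \<in> parcs H" "u \<noteq> w" "v \<noteq> w"
      using divide e by (auto dest: H.arcs_symmetric H.wellformed')
    have "x \<in> set q" if x: "x \<in> pverts (subdivide H e w)" "card (?E' `` {x}) \<ge> 3" for x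
    proof (cases "x = w")
      case True
      have "?E' `` {w} \<subseteq> {u, v}"
        using divide uv unfolding E' by (auto dest: H.wellformed')
      then have "card (?E' `` {w}) \<le> card {u, v}" by (intro card_mono) auto
      also have "\<dots> \<le> 2" by (simp add: card_insert_if)
      finally show ?thesis using x True by simp
    next
      case False
      then have xH: "x \<in> pverts H" using x by simp
      have fin: "finite (parcs H `` {x})"
        by (rule finite_subset[OF _ H.pair_finite_verts]) (auto dest: H.wellformed')
      \<comment> \<open>At an end of the subdivided edge, \<open>w\<close> takes the place of the
        other end.\<close>
      have "?E' `` {x} \<subseteq> (\<lambda>y. if (x, y) \<in> {(u, v), (v, u)} then w else y) ` (parcs H `` {x})"
      proof
        fix y assume "y \<in> ?E' `` {x}"
        then have xy: "(x, y) \<in> ?E'" by simp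
        show "y \<in> (\<lambda>y. if (x, y) \<in> {(u, v), (v, u)} then w else y) ` (parcs H `` {x})"
        proof (cases "y = w")
          case True
          then have "x = u \<or> x = v"
            using xy divide uv unfolding E' by (auto dest: H.wellformed')
          then show ?thesis
            using True uv by (elim disjE) (auto intro: image_eqI[of _ _ v] image_eqI[of _ _ u])
        next
          case no: False
          then have "(x, y) \<in> parcs H" "(x, y) \<notin> {(u, v), (v, u)}"
            using xy False unfolding E' by auto
          then show ?thesis by (intro image_eqI[of _ _ y]) auto
        qed
      qed
      then have "card (?E' `` {x}) \<le> card (parcs H `` {x})"
        using card_image_le[OF fin] card_mono[OF finite_imageI[OF fin]] by (meson order_trans)
      then show ?thesis using x xH p q by auto
    qed
    moreover have "set q \<subseteq> pverts (subdivide H e w)" using q p by auto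
    ultimately show ?case using q(1) by (intro exI[of _ q]) auto
  qed
qed

text \<open>The inverse of a subdivision step. Since \<open>H\<close> has no cycle, \<open>a\<close>
  and \<open>b\<close> are not adjacent, so the edge joining them is new and its subdivision gives
  back \<open>H\<close>.\<close>

lemma suppress_vertex:
  assumes H: "undirected_tree H" and aw: "(w, a) \<in> parcs H" "(w, b) \<in> parcs H" "a \<noteq> b" "parcs H `` {w} = {a, b}"
  defines "E \<equiv> parcs H"
  defines "G \<equiv> \<lparr>pverts = pverts H - {w}, parcs = E \<inter> (- {w}) \<times> (- {w}) \<union> {(a, b), (b, a)}\<rparr>"
  shows "undirected_tree G" "H = subdivide G (a, b) w" "(a, b) \<in> parcs G"
    and "\<And>v. v \<noteq> w \<Longrightarrow> card (parcs G `` {v}) \<le> card (E `` {v})"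
proof -
  interpret H: pair_graph H using H by (simp add: undirected_tree_iff)
  have F: "forest_rel E" and conn: "\<And>u v. u \<in> pverts H \<Longrightarrow> v \<in> pverts H \<Longrightarrow> (u, v) \<in> E\<^sup>*"
    using H by (auto simp: undirected_tree_iff E_def)
  have symE: "sym E" using F by (simp add: forest_rel_def)
  have nbrs: "(w, x) \<in> E \<longleftrightarrow> x = a \<or> x = b" "(x, w) \<in> E \<longleftrightarrow> x = a \<or> x = b" for x
    using aw(4) symE by (auto simp: E_def dest: symD)
  have ne: "a \<noteq> w" "b \<noteq> w" using nbrs forest_rel_irrefl[OF F] by metis+
  have ab_V: "a \<in> pverts H" "b \<in> pverts H" "w \<in> pverts H" using aw by (auto dest: H.wellformed')
  let ?E0 = "E \<inter> (- {w}) \<times> (- {w})"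
  have no_path: "(a, b) \<notin> ?E0\<^sup>*" using forest_rel_no_cycle[OF F, of w a b] nbrs aw by auto
  then have ab: "(a, b) \<notin> E" "(b, a) \<notin> E" using ne symE by (auto dest: symD)
  have G_arcs: "parcs G = ?E0 \<union> {(a, b), (b, a)}" by (simp add: G_def)
  have symG: "sym (parcs G)" using symE by (auto simp: G_arcs sym_def)
  show abG: "(a, b) \<in> parcs G" by (simp add: G_def)
  have "E = parcs G - {(a, b), (b, a)} \<union> {(a, w), (w, a), (w, b), (b, w)}"
    using ab nbrs by (auto simp: G_arcs)
  then have "parcs (subdivide G (a, b) w) = parcs H" unfolding arcs_subdivide E_def by simp
  moreover have "pverts (subdivide G (a, b) w) = pverts H" using ab_V by (auto simp: G_def)
  ultimately show "H = subdivide G (a, b) w" by simp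
  show "card (parcs G `` {v}) \<le> card (E `` {v})" if "v \<noteq> w" for v
  proof -
    have fin: "finite (E `` {v})"
      by (rule finite_subset[OF _ H.pair_finite_verts]) (auto simp: E_def dest: H.wellformed')
    have "parcs G `` {v} \<subseteq> (\<lambda>x. if x = w then if v = a then b else a else x) ` (E `` {v})"
    proof
      fix y assume "y \<in> parcs G `` {v}"
      then consider "(v, y) \<in> ?E0" | "v = a" "y = b" | "v = b" "y = a" by (auto simp: G_arcs)
      then show "y \<in> (\<lambda>x. if x = w then if v = a then b else a else x) ` (E `` {v})"
      proof cases
        case 1
        then show ?thesis by (intro image_eqI[of _ _ y]) auto
      qed (use nbrs aw in \<open>auto intro!: image_eqI[of _ _ w]\<close>)
    qed
    then show ?thesis
      using card_image_le[OF fin] card_mono[OF finite_imageI[OF fin]] by (meson order_trans)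
  qed
  \<comment> \<open>The new edge is a bridge because \<open>a\<close> and \<open>b\<close> are not
    connected off \<open>w\<close>. For any other edge, a walk around it in \<open>G\<close> becomes
    one in \<open>H\<close> by the detour through \<open>w\<close>.\<close>
  have "forest_rel (parcs G)"
    unfolding forest_rel_def
  proof (intro conjI allI impI symG)
    fix u v assume uv: "(u, v) \<in> parcs G"
    show "(u, v) \<notin> (parcs G - {(u, v), (v, u)})\<^sup>*"
    proof (cases "{u, v} = {a, b}")
      case True
      then have "parcs G - {(u, v), (v, u)} = ?E0" using ab by (auto simp: G_arcs doubleton_eq_iff)
      moreover have "(b, a) \<notin> ?E0\<^sup>*"
        using no_path sym_rtrancl_swap[of ?E0 b a] symE by (auto simp: sym_def)
      ultimately show ?thesis using no_path True by (auto simp: doubleton_eq_iff)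
    next
      case False
      then have uv0: "(u, v) \<in> ?E0" using uv by (auto simp: G_arcs)
      have "(a, w) \<in> E - {(u, v), (v, u)}" "(w, b) \<in> E - {(u, v), (v, u)}"
        "(b, w) \<in> E - {(u, v), (v, u)}" "(w, a) \<in> E - {(u, v), (v, u)}"
        using uv0 nbrs by auto
      then have "(a, b) \<in> (E - {(u, v), (v, u)})\<^sup>*" "(b, a) \<in> (E - {(u, v), (v, u)})\<^sup>*"
        by (auto intro: converse_rtrancl_into_rtrancl)
      then have "parcs G - {(u, v), (v, u)} \<subseteq> (E - {(u, v), (v, u)})\<^sup>*"
        unfolding G_arcs by auto
      then have "(parcs G - {(u, v), (v, u)})\<^sup>* \<subseteq> (E - {(u, v), (v, u)})\<^sup>*"
        by (rule rtrancl_subset_rtrancl)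
      then show ?thesis using F uv0 by (auto simp: forest_rel_def)
    qed
  qed
  moreover have "(u, v) \<in> (parcs G)\<^sup>*" if uv: "u \<in> pverts G" "v \<in> pverts G" for u v
  proof -
    have u: "u \<noteq> w" and v: "v \<noteq> w" and "(u, v) \<in> E\<^sup>*" using uv conn by (auto simp: G_def)
    \<comment> \<open>A walk of \<open>H\<close> is projected to \<open>G\<close> by letting
      \<open>a\<close> stand for \<open>w\<close>.\<close>
    from this(3) have "(u, if v = w then a else v) \<in> (parcs G)\<^sup>*"
    proof (induction rule: rtrancl_induct)
      case base
      then show ?case using u by simp
    next
      case (step y z)
      have ba: "(b, a) \<in> parcs G" using abG symG by (auto dest: symD)
      consider "y = w" | "y \<noteq> w" "z = w" | "y \<noteq> w" "z \<noteq> w" by blast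
      then show ?case
      proof cases
        case 1
        then have "z = a \<or> z = b" using step.hyps nbrs by simp
        then show ?thesis using 1 step.IH abG ne by (auto intro: rtrancl_into_rtrancl)
      next
        case 2
        then have "y = a \<or> y = b" using step.hyps nbrs by simp
        then show ?thesis using 2 step.IH ba by (auto intro: rtrancl_into_rtrancl)
      next
        case 3
        then have "(y, z) \<in> parcs G" using step.hyps by (simp add: G_arcs)
        then show ?thesis using 3 step.IH by (auto intro: rtrancl_into_rtrancl)
      qed
    qed
    then show ?thesis using v by simp
  qed
  moreover have "pair_graph G"
    unfolding G_def
  proof (rule pair_graphI)
    show "finite (pverts H - {w})" using H.pair_finite_verts by simp
    show "?E0 \<union> {(a, b), (b, a)} \<subseteq> (pverts H - {w}) \<times> (pverts H - {w})"
      using ab_V ne by (auto simp: E_def dest: H.wellformed')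
    show "sym (?E0 \<union> {(a, b), (b, a)})" using symG by (simp add: G_arcs)
    show "(v, v) \<notin> ?E0 \<union> {(a, b), (b, a)}" for v using forest_rel_irrefl[OF F] aw by auto
  qed
  moreover have "pverts G \<noteq> {}" using ab_V ne by (auto simp: G_def)
  ultimately show "undirected_tree G" by (simp add: undirected_tree_iff)
qed

text \<open>Vertices of degree 2 off the path are suppressed one by one; the path survives and
  degrees do not grow. When none is left, all vertices of degree above 1 lie on the path.\<close>

lemma path_cover_subdivided_caterpillar:
  assumes "undirected_tree H" "rel_path (parcs H) p" "set p \<subseteq> pverts H"
    "{v \<in> pverts H. card (parcs H `` {v}) \<ge> 3} \<subseteq> set p"
  shows "subdivided_caterpillar H"
proof -
  have "\<exists>G. caterpillar G \<and> subdivision_pair G H"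
    using assms
  proof (induction "card (pverts H)" arbitrary: H rule: less_induct)
    case less
    interpret H: pair_graph H using less.prems by (simp add: undirected_tree_iff)
    have fin: "finite (parcs H `` {x})" for x
      by (rule finite_subset[OF _ H.pair_finite_verts]) (auto dest: H.wellformed')
    show ?case
    proof (cases "\<exists>w \<in> pverts H - set p. card (parcs H `` {w}) = 2")
      case False
      have "v \<in> set p" if v: "v \<in> pverts H" "card (parcs H `` {v}) > 1" for v
      proof (rule ccontr)
        assume no: "v \<notin> set p"
        then have "card (parcs H `` {v}) \<noteq> 2" using False v by blast
        moreover have "\<not> card (parcs H `` {v}) \<ge> 3" using less.prems(4) v no by blast
        ultimately show False using v by simp
      qed
      then have "caterpillar H"
        using less.prems unfolding caterpillar_def vpath_iff_rel_path out_degree_with_proj by blast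
      moreover have "subdivision_pair H H"
        by (intro subdivision_pair_base) unfold_locales
      ultimately show ?thesis by blast
    next
      case True
      then obtain w a b where w: "w \<in> pverts H" "w \<notin> set p" "parcs H `` {w} = {a, b}" "a \<noteq> b"
        by (auto simp: card_2_iff)
      then have ab: "(w, a) \<in> parcs H" "(w, b) \<in> parcs H" by auto
      define G where "G = \<lparr>pverts = pverts H - {w}, parcs = parcs H \<inter> (- {w}) \<times> (- {w}) \<union> {(a, b), (b, a)}\<rparr>"
      note G = suppress_vertex[OF less.prems(1) ab w(4,3), folded G_def]
      have "card (pverts G) < card (pverts H)"
        using card_Diff1_less[OF H.pair_finite_verts w(1)] by (simp add: G_def)
      moreover have "rel_path (parcs G) p"
      proof -
        have "successively (\<lambda>x y. (x, y) \<in> parcs G) p"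
          using less.prems(2) w(2) unfolding rel_path_def
          by (auto simp: G_def elim!: successively_mono)
        then show ?thesis using less.prems(2) by (simp add: rel_path_def)
      qed
      moreover have "set p \<subseteq> pverts G" using less.prems(3) w by (auto simp: G_def)
      moreover have "{v \<in> pverts G. card (parcs G `` {v}) \<ge> 3} \<subseteq> set p"
      proof
        fix v assume v: "v \<in> {v \<in> pverts G. card (parcs G `` {v}) \<ge> 3}"
        then have "v \<in> pverts H" "v \<noteq> w" by (auto simp: G_def)
        then show "v \<in> set p" using G(4)[of v] v less.prems(4) by auto
      qed
      ultimately obtain C where C: "caterpillar C" "subdivision_pair C G"
        using less.hyps[of G] G(1) by blast
      have "subdivision_pair C (subdivide G (a, b) w)"
        by (rule subdivision_pair_divide[OF G(3) _ C(2)]) (simp add: G_def)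
      then show ?thesis using C G(2) by auto
    qed
  qed
  then show ?thesis using assms by (simp add: subdivided_caterpillar_def)
qed

section \<open>Unit rectangle visibility trees\<close>

lemma bands_iff_sees:
  fixes S :: "'a \<Rightarrow> (real \<times> real) set" and X Y :: "'a \<Rightarrow> real"
  assumes S: "\<And>v. v \<in> V \<Longrightarrow> S v = cbox (X v, Y v) (X v + 1, Y v + 1)"
    and sep: "\<And>v w. v \<in> V \<Longrightarrow> w \<in> V \<Longrightarrow> v \<noteq> w \<Longrightarrow> \<bar>X v - X w\<bar> \<ge> 1 \<or> \<bar>Y v - Y w\<bar> \<ge> 1"
    and vw: "v \<in> V" "w \<in> V"
  shows "horizontal_band V S v w \<longleftrightarrow> sees V Y X v w" "vertical_band V S v w \<longleftrightarrow> sees V X Y v w"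
proof -
  have closed: "S u = {p. X u \<le> fst p \<and> fst p \<le> X u + 1 \<and> Y u \<le> snd p \<and> snd p \<le> Y u + 1}" if "u \<in> V" for u
    unfolding S[OF that] by (auto simp: cbox_Pair_eq)
  have opened: "interior (S u) = {p. X u < fst p \<and> fst p < X u + 1 \<and> Y u < snd p \<and> snd p < Y u + 1}"
    if "u \<in> V" for u
    unfolding S[OF that] by (auto simp: box_prod)
  show "horizontal_band V S v w \<longleftrightarrow> sees V Y X v w"
    by (rule visibility_band_iff_sees[OF _ _ _ _ vw]) (use closed opened sep in auto)
  have "visibility_band snd fst V S v w \<longleftrightarrow> sees V X Y v w"
  proof (rule visibility_band_iff_sees[OF _ _ _ _ vw])
    show "\<exists>p. snd p = a \<and> fst p = b" for a b :: real by auto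
    show "S u = {p. Y u \<le> snd p \<and> snd p \<le> Y u + 1 \<and> X u \<le> fst p \<and> fst p \<le> X u + 1}" if "u \<in> V" for u
      unfolding closed[OF that] by auto
    show "interior (S u) = {p. Y u < snd p \<and> snd p < Y u + 1 \<and> X u < fst p \<and> fst p < X u + 1}"
      if "u \<in> V" for u
      unfolding opened[OF that] by auto
    show "\<bar>Y u - Y u'\<bar> \<ge> 1 \<or> \<bar>X u - X u'\<bar> \<ge> 1" if "u \<in> V" "u' \<in> V" "u \<noteq> u'" for u u'
      using sep[OF that] by auto
  qed
  then show "vertical_band V S v w \<longleftrightarrow> sees V X Y v w" .
qed

lemma unit_squares_disjoint_iff:
  fixes x y x' y' :: real
  shows "interior (cbox (x, y) (x + 1, y + 1)) \<inter> interior (cbox (x', y') (x' + 1, y' + 1)) = {} \<longleftrightarrow>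
    \<bar>x - x'\<bar> \<ge> 1 \<or> \<bar>y - y'\<bar> \<ge> 1"
proof
  assume disj: "interior (cbox (x, y) (x + 1, y + 1)) \<inter> interior (cbox (x', y') (x' + 1, y' + 1)) = {}"
  show "\<bar>x - x'\<bar> \<ge> 1 \<or> \<bar>y - y'\<bar> \<ge> 1"
  proof (rule ccontr)
    assume "\<not> (\<bar>x - x'\<bar> \<ge> 1 \<or> \<bar>y - y'\<bar> \<ge> 1)"
    then have "((x + x' + 1) / 2, (y + y' + 1) / 2) \<in>
      interior (cbox (x, y) (x + 1, y + 1)) \<inter> interior (cbox (x', y') (x' + 1, y' + 1))"
      by (auto simp: box_prod)
    then show False using disj by blast
  qed
qed (auto simp: box_prod)

section \<open>From a representation to two forests\<close>

context unit_bars
begin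

lemma edges_subset: "E \<subseteq> V \<times> V"
  by (auto simp: E_def)

lemma pair_graph: "pair_graph \<lparr>pverts = V, parcs = E\<rparr>"
  using fin edges_subset symE forest_rel_irrefl[OF forest] by (intro pair_graphI) auto

lemma subdivided_caterpillar_forest: "subdivided_caterpillar_forest \<lparr>pverts = V, parcs = E\<rparr>"
  unfolding subdivided_caterpillar_forest_def
proof (intro conjI allI impI)
  show "undirected_forest \<lparr>pverts = V, parcs = E\<rparr>"
    using pair_graph forest by (simp add: undirected_forest_iff)
  fix C assume "with_proj C \<in> pre_digraph.sccs (with_proj \<lparr>pverts = V, parcs = E\<rparr>)"
  then obtain x where x: "x \<in> V" and
    C: "C = \<lparr>pverts = E\<^sup>* `` {x}, parcs = E \<inter> (E\<^sup>* `` {x}) \<times> (E\<^sup>* `` {x})\<rparr>"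
    unfolding sccs_pair_graph[OF pair_graph] by auto
  define K where "K = E\<^sup>* `` {x}"
  have closed: "E `` K \<subseteq> K" by (auto simp: K_def intro: rtrancl_into_rtrancl)
  have KV: "K \<subseteq> V" using x edges_subset by (auto simp: K_def elim: rtranclE)
  have symC: "sym (E \<inter> K \<times> K)" using symE by (auto simp: sym_def)
  have "undirected_tree C"
    unfolding undirected_tree_iff
  proof (intro conjI ballI)
    show "pair_graph C"
      unfolding C K_def[symmetric] using finite_subset[OF KV fin] symC forest_rel_irrefl[OF forest]
      by (intro pair_graphI) auto
    show "forest_rel (parcs C)"
      unfolding C K_def[symmetric] using symC by (auto intro: forest_rel_subset[OF forest])
    show "pverts C \<noteq> {}" by (auto simp: C)
    have to: "(x, u) \<in> (parcs C)\<^sup>*" if "u \<in> pverts C" for u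
      using rtrancl_Restr_closed[OF _ _ closed, of x u] that by (auto simp: C K_def)
    have symC': "sym (parcs C)" using symC by (simp add: C K_def)
    fix u v assume "u \<in> pverts C" "v \<in> pverts C"
    then show "(u, v) \<in> (parcs C)\<^sup>*"
      using rtrancl_trans[OF sym_rtrancl_swap[OF symC' to] to] by blast
  qed
  moreover obtain p where p: "rel_path E p" "set p \<subseteq> K" "{v \<in> K. card (E `` {v}) \<ge> 3} \<subseteq> set p"
    using path_cover[OF x] by (auto simp: K_def)
  moreover have "rel_path (parcs C) p"
    using p(1,2) unfolding C K_def[symmetric] rel_path_def by (auto elim!: successively_mono)
  moreover have "parcs C `` {v} = E `` {v}" if "v \<in> K" for v
    using that closed by (auto simp: C K_def[symmetric])
  ultimately show "subdivided_caterpillar C"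
    by (intro path_cover_subdivided_caterpillar[of C p]) (auto simp: C K_def)
qed

lemma max_degree: "max_degree_at_most 3 \<lparr>pverts = V, parcs = E\<rparr>"
  using degree_le_3 by (simp add: max_degree_at_most_def out_degree_with_proj)

end

lemma URVG_imp_union:
  assumes T: "undirected_forest T" and "URVG T"
  shows "\<exists>F1 F2. subgraph (with_proj F1) (with_proj T) \<and> subgraph (with_proj F2) (with_proj T) \<and>
       subdivided_caterpillar_forest F1 \<and> max_degree_at_most 3 F1 \<and>
       subdivided_caterpillar_forest F2 \<and> max_degree_at_most 3 F2 \<and>
       parcs T \<subseteq> parcs F1 \<union> parcs F2"
proof -
  interpret T: pair_graph T using T by (simp add: undirected_forest_iff)
  let ?V = "pverts T"
  obtain S where S': "(\<forall>v \<in> ?V. unit_square (S v)) \<and>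
      pairwise (\<lambda>v w. interior (S v) \<inter> interior (S w) = {}) ?V \<and>
      (\<forall>v \<in> ?V. \<forall>w \<in> ?V. v \<noteq> w \<longrightarrow>
        ((v, w) \<in> parcs T \<longleftrightarrow> horizontal_band ?V S v w \<or> vertical_band ?V S v w))"
    using conjunct2[OF \<open>URVG T\<close>[unfolded URVG_def]] by (rule exE)
  note square = bspec[OF conjunct1[OF S']]
    and disj = conjunct1[OF conjunct2[OF S']]
    and adj = conjunct2[OF conjunct2[OF S'], rule_format]
  have ex: "\<forall>v. \<exists>ab. v \<in> ?V \<longrightarrow> S v = cbox ab (fst ab + 1, snd ab + 1)"
  proof
    fix v
    show "\<exists>ab. v \<in> ?V \<longrightarrow> S v = cbox ab (fst ab + 1, snd ab + 1)"
    proof (cases "v \<in> ?V")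
      case True
      then obtain a b where "S v = cbox (a, b) (a + 1, b + 1)"
        using square unfolding unit_square_def by blast
      then show ?thesis by (intro exI[of _ "(a, b)"]) simp
    qed simp
  qed
  obtain c where c: "\<And>v. v \<in> ?V \<Longrightarrow> S v = cbox (c v) (fst (c v) + 1, snd (c v) + 1)"
    using choice[OF ex] by blast
  define X where "X v = fst (c v)" for v
  define Y where "Y v = snd (c v)" for v
  have S: "S v = cbox (X v, Y v) (X v + 1, Y v + 1)" if "v \<in> ?V" for v
    using c[OF that] by (simp add: X_def Y_def)
  have sep: "\<bar>X v - X w\<bar> \<ge> 1 \<or> \<bar>Y v - Y w\<bar> \<ge> 1" if "v \<in> ?V" "w \<in> ?V" "v \<noteq> w" for v w
    using pairwiseD[OF disj that] unfolding S[OF that(1)] S[OF that(2)] unit_squares_disjoint_iff .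
  have bands: "horizontal_band ?V S v w \<longleftrightarrow> sees ?V Y X v w" "vertical_band ?V S v w \<longleftrightarrow> sees ?V X Y v w"
    if "v \<in> ?V" "w \<in> ?V" for v w
    by (rule bands_iff_sees[OF S sep that]; assumption)+
  define visible where "visible t s = {(v, w). v \<in> ?V \<and> w \<in> ?V \<and> v \<noteq> w \<and> sees ?V t s v w}" for t s
  have parcs: "parcs T = visible Y X \<union> visible X Y"
  proof -
    have "(v, w) \<in> parcs T \<longleftrightarrow> (v, w) \<in> visible Y X \<union> visible X Y" for v w
    proof (cases "v \<in> ?V \<and> w \<in> ?V \<and> v \<noteq> w")
      case True
      then show ?thesis using adj[of v w] bands[of v w] by (simp add: visible_def)
    next
      case False
      then show ?thesis by (auto simp: visible_def dest: T.wellformed' T.no_loops)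
    qed
    then show ?thesis by auto
  qed
  have forest: "forest_rel (parcs T)" using T by (simp add: undirected_forest_iff)
  have "sym (visible t s)" for t s
    by (auto simp: visible_def sym_def sees_sym[THEN iffD1])
  then have "forest_rel (visible Y X)" "forest_rel (visible X Y)"
    using parcs by (auto intro!: forest_rel_subset[OF forest])
  then have bars: "unit_bars ?V Y X (visible Y X)" "unit_bars ?V X Y (visible X Y)"
    using T.pair_finite_verts sep by (unfold_locales; force simp: visible_def)+
  have "subgraph (with_proj \<lparr>pverts = ?V, parcs = visible t s\<rparr>) (with_proj T)"
    if "unit_bars ?V t s (visible t s)" "visible t s \<subseteq> parcs T" for t s
  proof -
    interpret F: pair_graph "\<lparr>pverts = ?V, parcs = visible t s\<rparr>" by (rule unit_bars.pair_graph[OF that(1)])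
    show ?thesis
      unfolding subgraph_def using that T.wf_digraph_axioms F.wf_digraph_axioms
      by (simp add: compatible_def)
  qed
  then show ?thesis
    using bars parcs unit_bars.subdivided_caterpillar_forest[OF bars(1)] unit_bars.subdivided_caterpillar_forest[OF bars(2)]
      unit_bars.max_degree[OF bars(1)] unit_bars.max_degree[OF bars(2)]
    by (intro exI[of _ "\<lparr>pverts = ?V, parcs = visible Y X\<rparr>"] exI[of _ "\<lparr>pverts = ?V, parcs = visible X Y\<rparr>"]) auto
qed

section \<open>From two forests to a representation\<close>

lemma subdivided_caterpillar_forest_coords:
  assumes F: "subdivided_caterpillar_forest F" "max_degree_at_most 3 F"
  shows "\<exists>lev d. coords (parcs F) lev d"
proof -
  let ?E = "parcs F"
  have pg: "pair_graph F" and forest: "forest_rel ?E"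
    using F by (auto simp: subdivided_caterpillar_forest_def undirected_forest_iff)
  interpret pair_graph F by fact
  have symE: "sym ?E" using forest by (simp add: forest_rel_def)
  show ?thesis
  proof (rule coords_from_components[OF symE])
    fix x
    define K where "K = ?E\<^sup>* `` {x}"
    have closed: "?E `` K \<subseteq> K" by (auto simp: K_def intro: rtrancl_into_rtrancl)
    show "\<exists>lev d. coords (?E \<inter> (?E\<^sup>* `` {x}) \<times> (?E\<^sup>* `` {x})) lev d"
    proof (cases "x \<in> pverts F")
      case False
      then have "K = {x}" by (auto simp: K_def elim: converse_rtranclE dest: wellformed')
      then have "?E \<inter> K \<times> K = {}" using False by (auto dest: wellformed')
      then show ?thesis by (auto simp: K_def[symmetric] coords_def)
    next
      case True
      then have KV: "K \<subseteq> pverts F" by (auto simp: K_def elim: rtranclE dest: wellformed')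
      define C where "C = \<lparr>pverts = K, parcs = ?E \<inter> K \<times> K\<rparr>"
      have "with_proj C \<in> pre_digraph.sccs (with_proj F)"
        unfolding sccs_pair_graph[OF pg] using True by (intro bexI[of _ x]) (auto simp: C_def K_def)
      then have "subdivided_caterpillar C" using F by (simp add: subdivided_caterpillar_forest_def)
      from subdivided_caterpillar_path_cover[OF this] obtain p where
        p: "rel_path (?E \<inter> K \<times> K) p" "set p \<subseteq> K" "{v \<in> K. card ((?E \<inter> K \<times> K) `` {v}) \<ge> 3} \<subseteq> set p"
        by (auto simp: C_def)
      have nbrs: "(?E \<inter> K \<times> K) `` {v} = ?E `` {v}" if "v \<in> K" for v using that closed by auto
      have "rel_path ?E p" using p(1) unfolding rel_path_def by (auto elim!: successively_mono)
      moreover have "{v \<in> K. card (?E `` {v}) \<ge> 3} \<subseteq> set p" using p(3) nbrs by auto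
      moreover have "card (?E `` {v}) \<le> 3" if "v \<in> K" for v
        using F(2) that KV by (auto simp: max_degree_at_most_def out_degree_with_proj)
      moreover have "finite K" using KV pair_finite_verts by (rule finite_subset)
      moreover have "(u, v) \<in> ?E\<^sup>*" if "u \<in> K" "v \<in> K" for u v
        using that rtrancl_trans[OF sym_rtrancl_swap[OF symE, of x u], of v] by (simp add: K_def)
      ultimately show ?thesis
        using component_coords[OF forest _ closed _ _ _ p(2)] unfolding K_def[symmetric] by blast
    qed
  qed
qed

text \<open>
  A potential separates the components of \<^term>\<open>E1\<close> and sorts them along the edges of \<^term>\<open>E2\<close>;
  its values are perturbed by an enumeration of the components of \<^term>\<open>E1\<close> to make them distinct.
\<close>

lemma spread_components:
  fixes lev1 :: "'a \<Rightarrow> nat" and \<rho> :: "'a \<Rightarrow> int"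
  assumes V: "finite V" "E1 \<union> E2 \<subseteq> V \<times> V" and forest: "forest_rel (E1 \<union> E2)" and disj: "E1 \<inter> E2 = {}"
    and sym: "sym E1" "sym E2"
  obtains off :: "'a \<Rightarrow> real" where
    "\<And>u v. (u, v) \<in> E1\<^sup>* \<Longrightarrow> off u = off v"
    "\<And>u v. u \<in> V \<Longrightarrow> v \<in> V \<Longrightarrow> (u, v) \<notin> E1\<^sup>* \<Longrightarrow>
       \<bar>(real (lev1 u) / 2 + off u) - (real (lev1 v) / 2 + off v)\<bar> \<ge> 1"
    "\<And>u v. (u, v) \<in> E2 \<Longrightarrow> \<rho> v = \<rho> u + 1 \<Longrightarrow> real (lev1 u) / 2 + off u < real (lev1 v) / 2 + off v"
proof -
  have "finite (E1 \<union> E2)" using V by (meson finite_SigmaI finite_subset)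
  \<comment> \<open>Zero on \<open>E1\<close>, so that \<open>g\<close> is constant on its
    components, and the difference of ranks on \<open>E2\<close>, so that \<open>g\<close> rises by
    1 along ascending edges.\<close>
  define \<delta> where "\<delta> u v = (if (u, v) \<in> E2 then \<rho> v - \<rho> u else 0)" for u v
  have "\<delta> v u = - \<delta> u v" if "(u, v) \<in> E1 \<union> E2" for u v
    using sym(2) by (auto simp: \<delta>_def dest: symD)
  from forest_rel_potential[OF \<open>finite (E1 \<union> E2)\<close> forest, of \<delta>, OF this] obtain g where
    g: "\<And>u v. (u, v) \<in> E1 \<union> E2 \<Longrightarrow> g v - g u = \<delta> u v" by blast
  define comp where "comp v = E1\<^sup>* `` {v}" for v
  have comp_eq: "comp u = comp v \<longleftrightarrow> (u, v) \<in> E1\<^sup>*" for u v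
    using sym_rtrancl_swap[OF sym(1)] by (auto simp: comp_def intro: rtrancl_trans)
  obtain f :: "'a set \<Rightarrow> nat" and m where f: "f ` comp ` V = {i. i < m}" "inj_on f (comp ` V)"
    using finite_imp_inj_to_nat_seg[of "comp ` V"] V by blast
  define \<kappa> where "\<kappa> v = int (f (comp v))" for v
  have \<kappa>: "0 \<le> \<kappa> v" "\<kappa> v < int m" if "v \<in> V" for v using f that by (auto simp: \<kappa>_def)
  \<comment> \<open>Scaling by \<open>m\<close> leaves room for the component index \<kappa>, which
    is recovered modulo \<open>m\<close>; a rise of \<open>g\<close> by 1 still outweighs any change
    of \<kappa>.\<close>
  define h where "h v = int m * g v + \<kappa> v" for v
  have h_neq: "h u \<noteq> h v" if "u \<in> V" "v \<in> V" "(u, v) \<notin> E1\<^sup>*" for u v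
  proof
    assume "h u = h v"
    then have "h u mod int m = h v mod int m" by simp
    then have "\<kappa> u = \<kappa> v" using \<kappa> that by (simp add: h_def)
    then have "comp u = comp v" using f(2) that by (auto simp: \<kappa>_def inj_on_eq_iff)
    then show False using comp_eq that by simp
  qed
  have h_less: "h u + 1 \<le> h v" if "(u, v) \<in> E2" "\<rho> v = \<rho> u + 1" for u v
  proof -
    have "g v = g u + 1" using g[of u v] that by (simp add: \<delta>_def)
    moreover have "u \<in> V" "v \<in> V" using that V by auto
    ultimately show ?thesis using \<kappa>[of u] \<kappa>[of v] by (simp add: h_def distrib_left)
  qed
  have h_eq: "h u = h v" if "(u, v) \<in> E1\<^sup>*" for u v
  proof -
    have "g u = g v" using that
    proof (induction rule: rtrancl_induct)
      case (step y z)
      then have "\<delta> y z = 0" using disj by (auto simp: \<delta>_def)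
      then show ?case using g[of y z] step by auto
    qed simp
    moreover have "\<kappa> u = \<kappa> v" using iffD2[OF comp_eq that] by (simp add: \<kappa>_def)
    ultimately show ?thesis by (simp add: h_def)
  qed
  define L where "L = Max (insert 0 (lev1 ` V))"
  have L: "lev1 v \<le> L" if "v \<in> V" for v using that V by (simp add: L_def)
  \<comment> \<open>Half levels vary by at most \<open>L / 2\<close> on \<open>V\<close>, so
    \<open>L + 1\<close> per unit of \<open>h\<close> leaves a gap of at least 1.\<close>
  define N where "N = real L + 1"
  define off where "off v = N * real_of_int (h v)" for v
  have gap: "real (lev1 u) / 2 + off u + 1 \<le> real (lev1 v) / 2 + off v" if "u \<in> V" "h u + 1 \<le> h v" for u v
  proof -
    have "N * (real_of_int (h u) + 1) \<le> N * real_of_int (h v)"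
      using that(2) by (intro mult_left_mono) (auto simp: N_def)
    then have "off u + N \<le> off v" by (simp add: off_def algebra_simps)
    moreover have "real (lev1 u) / 2 + 1 \<le> N" if "L > 0"
      using L[OF \<open>u \<in> V\<close>] that by (simp add: N_def)
    moreover have "real (lev1 u) / 2 + 1 \<le> N" if "L = 0"
      using L[OF \<open>u \<in> V\<close>] that by (simp add: N_def)
    ultimately show ?thesis by fastforce
  qed
  show thesis
  proof (rule that[of off])
    show "off u = off v" if "(u, v) \<in> E1\<^sup>*" for u v using h_eq[OF that] by (simp add: off_def)
    show "\<bar>(real (lev1 u) / 2 + off u) - (real (lev1 v) / 2 + off v)\<bar> \<ge> 1"
      if uv: "u \<in> V" "v \<in> V" "(u, v) \<notin> E1\<^sup>*" for u v
      using h_neq[OF uv] gap[of u v] gap[of v u] uv by linarith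
    show "real (lev1 u) / 2 + off u < real (lev1 v) / 2 + off v" if "(u, v) \<in> E2" "\<rho> v = \<rho> u + 1" for u v
      using gap[OF _ h_less[OF that]] that V by fastforce
  qed
qed

lemma union_imp_URVG:
  assumes T: "undirected_forest T"
    and sub: "subgraph (with_proj F1) (with_proj T)" "subgraph (with_proj F2) (with_proj T)"
    and F1: "subdivided_caterpillar_forest F1" "max_degree_at_most 3 F1"
    and F2: "subdivided_caterpillar_forest F2" "max_degree_at_most 3 F2"
    and cover: "parcs T \<subseteq> parcs F1 \<union> parcs F2"
  shows "URVG T"
proof -
  interpret T: pair_graph T using T by (simp add: undirected_forest_iff)
  have forest: "forest_rel (parcs T)" using T by (simp add: undirected_forest_iff)
  let ?V = "pverts T"
  define E1 where "E1 = parcs F1"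
  \<comment> \<open>Edges in both forests are left to \<open>E1\<close>; a layout of
    \<open>F2\<close> restricts to the remaining edges by \<open>coords_subset\<close>.\<close>
  define E2 where "E2 = parcs F2 - parcs F1"
  have "sym (parcs F1)" "sym (parcs F2)"
    using F1 F2 by (auto simp: subdivided_caterpillar_forest_def undirected_forest_iff forest_rel_def)
  then have sym: "sym E1" "sym E2" by (auto simp: E1_def E2_def sym_def)
  have parcs: "parcs T = E1 \<union> E2" using sub cover by (auto simp: E1_def E2_def subgraph_def)
  have disj: "E1 \<inter> E2 = {}" by (auto simp: E1_def E2_def)
  have V: "E1 \<union> E2 \<subseteq> ?V \<times> ?V" unfolding parcs[symmetric] by (auto dest: T.wellformed')
  have forest12: "forest_rel (E1 \<union> E2)" using forest parcs by simp
  obtain lev1 d1 where coords1: "coords E1 lev1 d1"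
    using subdivided_caterpillar_forest_coords[OF F1] by (auto simp: E1_def)
  obtain lev2 d2 where coords2: "coords E2 lev2 d2"
    using subdivided_caterpillar_forest_coords[OF F2] coords_subset[of "parcs F2" _ _ E2]
    by (auto simp: E2_def)
  \<comment> \<open>Vertical shifts of the components of \<open>E1\<close> keep them off each
    other's horizontal sight lines and at the same time sort the ends of \<open>E2\<close> edges,
    which look vertically. \<open>off2\<close> does the same with the roles exchanged.\<close>
  obtain off1 where off1: "\<And>u v. (u, v) \<in> E1\<^sup>* \<Longrightarrow> off1 u = off1 v"
    "\<And>u v. u \<in> ?V \<Longrightarrow> v \<in> ?V \<Longrightarrow> (u, v) \<notin> E1\<^sup>* \<Longrightarrow>
       \<bar>(real (lev1 u) / 2 + off1 u) - (real (lev1 v) / 2 + off1 v)\<bar> \<ge> 1"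
    "\<And>u v. (u, v) \<in> E2 \<Longrightarrow> coord_rank lev2 d2 v = coord_rank lev2 d2 u + 1 \<Longrightarrow>
       real (lev1 u) / 2 + off1 u < real (lev1 v) / 2 + off1 v"
    by (rule spread_components[OF T.pair_finite_verts V forest12 disj sym, of lev1 "coord_rank lev2 d2"]) (rule that)
  have "E2 \<union> E1 \<subseteq> ?V \<times> ?V" "forest_rel (E2 \<union> E1)" "E2 \<inter> E1 = {}"
    using V forest12 disj by (simp_all add: Un_commute Int_commute)
  note spread = spread_components[OF T.pair_finite_verts this sym(2,1), of lev2 "coord_rank lev1 d1"]
  obtain off2 where off2: "\<And>u v. (u, v) \<in> E2\<^sup>* \<Longrightarrow> off2 u = off2 v"
    "\<And>u v. u \<in> ?V \<Longrightarrow> v \<in> ?V \<Longrightarrow> (u, v) \<notin> E2\<^sup>* \<Longrightarrow>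
       \<bar>(real (lev2 u) / 2 + off2 u) - (real (lev2 v) / 2 + off2 v)\<bar> \<ge> 1"
    "\<And>u v. (u, v) \<in> E1 \<Longrightarrow> coord_rank lev1 d1 v = coord_rank lev1 d1 u + 1 \<Longrightarrow>
       real (lev2 u) / 2 + off2 u < real (lev2 v) / 2 + off2 v"
    by (rule spread) (rule that)
  define Y where "Y v = real (lev1 v) / 2 + off1 v" for v
  define X where "X v = real (lev2 v) / 2 + off2 v" for v
  define S where "S v = cbox (X v, Y v) (X v + 1, Y v + 1)" for v
  have sep: "\<bar>X v - X w\<bar> \<ge> 1 \<or> \<bar>Y v - Y w\<bar> \<ge> 1" if "v \<in> ?V" "w \<in> ?V" "v \<noteq> w" for v w
  proof -
    have "finite E1" using parcs T.pair_finite_arcs by simp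
    \<comment> \<open>Distinct vertices lie in different components of at least one relation, whose
      offsets put them at least 1 apart.\<close>
    then have "(v, w) \<notin> E1\<^sup>* \<or> (v, w) \<notin> E2\<^sup>*"
      using forest_rel_disjoint_union[OF _ forest12 sym disj, of v w] that by blast
    then show ?thesis
      using off1(2)[OF that(1,2)] off2(2)[OF that(1,2)] unfolding X_def Y_def by blast
  qed
  have sees_Y: "sees ?V Y X v w \<longleftrightarrow> (v, w) \<in> E1" if "v \<in> ?V" "w \<in> ?V" "v \<noteq> w" for v w
    by (rule sees_coords[OF sym(1) coords1 _ Y_def off1(1) _ _ that])
      (use V off1(2) off2(3) in \<open>auto simp: X_def Y_def\<close>)
  have sees_X: "sees ?V X Y v w \<longleftrightarrow> (v, w) \<in> E2" if "v \<in> ?V" "w \<in> ?V" "v \<noteq> w" for v w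
    by (rule sees_coords[OF sym(2) coords2 _ X_def off2(1) _ _ that])
      (use V off2(2) off1(3) in \<open>auto simp: X_def Y_def\<close>)
  show ?thesis
    unfolding URVG_def
  proof (intro conjI exI[of _ S] ballI impI)
    show "pair_graph T" ..
    show "unit_square (S v)" for v by (auto simp: unit_square_def S_def)
    show "pairwise (\<lambda>v w. interior (S v) \<inter> interior (S w) = {}) ?V"
    proof (rule pairwiseI)
      fix v w assume "v \<in> ?V" "w \<in> ?V" "v \<noteq> w"
      from sep[OF this] show "interior (S v) \<inter> interior (S w) = {}"
        unfolding S_def unit_squares_disjoint_iff .
    qed
    fix v w assume vw: "v \<in> ?V" "w \<in> ?V" "v \<noteq> w"
    have "horizontal_band ?V S v w \<longleftrightarrow> sees ?V Y X v w" "vertical_band ?V S v w \<longleftrightarrow> sees ?V X Y v w"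
      by (rule bands_iff_sees[OF S_def sep vw(1,2)]; assumption)+
    then show "(v, w) \<in> parcs T \<longleftrightarrow> horizontal_band ?V S v w \<or> vertical_band ?V S v w"
      using sees_X[OF vw] sees_Y[OF vw] parcs by simp
  qed
qed

theorem theorem4p5:
  fixes T :: "'a pair_pre_digraph"
  assumes "undirected_tree T"
  shows "URVG T \<longleftrightarrow>
    (\<exists>F1 F2. subgraph (with_proj F1) (with_proj T) \<and> subgraph (with_proj F2) (with_proj T) \<and>
       subdivided_caterpillar_forest F1 \<and> max_degree_at_most 3 F1 \<and>
       subdivided_caterpillar_forest F2 \<and> max_degree_at_most 3 F2 \<and>
       parcs T \<subseteq> parcs F1 \<union> parcs F2)"
  using assms URVG_imp_union union_imp_URVG unfolding undirected_tree_def by blast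

end
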